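(* Let $\bar d\ge 1$, $d=2\bar d$, and let $\chi$ be a probability distribution on $[0,1]^{\bar d}$. For $i\in\{S,C\}$ let $f^i_D:[0,1]^d\to\mathbb{R}$ be the \texttt{SUM} (for $i=S$) or \texttt{COUNT} (for $i=C$) query function of a database $D$ consisting of $n$ i.i.d. samples from $\chi$, and let $\rho_i$ be the Lipschitz constant (with respect to the $1$-norm on $[0,1]^d$) of the normalized distribution query function $\mathbf{q}\mapsto \frac1n\mathbb{E}_{D\sim\chi}[f^i_D(\mathbf{q})]$, assumed finite. Then there exist universal constants $\varkappa_1,\varkappa_2>0$ such that for every $\varepsilon_1,\varepsilon_2>0$ and $i\in\{S,C\}$ there exists a ReLU neural network $\hat f:[0,1]^d\to\mathbb{R}$ with space and query time complexity $\tilde O\big(d(\varkappa_1\rho_i d\,\varepsilon_1^{-1}+1)^d\big)$ (where $\tilde O$ hides logarithmic factors) such that $$\mathbb{P}_{D\sim\chi}\Big[\tfrac1n\big\|\hat f-f^i_D\big\|_1\ge \varepsilon_1+\varepsilon_2\Big]\le \varkappa_2^{d+1}\,d\,\varepsilon_2^{-d}\exp\!\big(-\varkappa_2^{-1}\varepsilon_2^2 n\big).$$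
   Context: A query is $\mathbf{q}=(\mathbf{c},\mathbf{r})\in[0,1]^d$ with $\mathbf{c},\mathbf{r}\in[0,1]^{\bar d}$; the set of queries is $\mathcal{Q}=\{(\mathbf{c},\mathbf{r})\in[0,1]^d: c_j+r_j\le 1\ \forall j\}$. A point $\mathbf{p}\in[0,1]^{\bar d}$ matches $\mathbf{q}$ if $c_j\le p_j<c_j+r_j$ for all $j$. Fix a measure attribute index $m\in\{1,\dots,\bar d\}$. The \texttt{COUNT} query function is $f^C_D(\mathbf{q})=|\{\mathbf{p}\in D:\mathbf{p}\text{ matches }\mathbf{q}\}|$ and the \texttt{SUM} query function is $f^S_D(\mathbf{q})=\sum_{\mathbf{p}\in D,\ \mathbf{p}\text{ matches }\mathbf{q}}p_m$. For functions $g,h$, $\|g-h\|_1=\int_{\mathbf{q}\in\mathcal{Q}}|g(\mathbf{q})-h(\mathbf{q})|\,d\mathbf{q}$. A function $g$ is $\rho$-Lipschitz if $|g(\mathbf{x})-g(\mathbf{x}')|\le\rho\|\mathbf{x}-\mathbf{x}'\|_1$. The space complexity of a network is the number of bits needed to store its parameters; its query time complexity is the number of operations of a forward pass. The probability is over drawing the database $D$; the network $\hat f$ is chosen before $D$ is drawn. *)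

theory Defs
  imports "HOL-Probability.Probability"
begin

text \<open>Points of [0,1]^dbar and queries of [0,1]^d (d = 2 dbar) are represented as
  functions nat => real; only the indices below the dimension matter.
  A query q has centre part c_j = q j and range part r_j = q (dbar + j), j < dbar.
  Attribute indices are 0-based.\<close>

datatype agg = SumQ | CountQ

definition matches :: "nat \<Rightarrow> (nat \<Rightarrow> real) \<Rightarrow> (nat \<Rightarrow> real) \<Rightarrow> bool" where
  "matches dbar p q \<longleftrightarrow> (\<forall>j<dbar. q j \<le> p j \<and> p j < q j + q (dbar + j))"

text \<open>A database of n points is an n-tuple D (D k is the k-th point, k < n);
  duplicates are counted with multiplicity.\<close>

definition query_fun ::
  "agg \<Rightarrow> nat \<Rightarrow> nat \<Rightarrow> nat \<Rightarrow> (nat \<Rightarrow> nat \<Rightarrow> real) \<Rightarrow> (nat \<Rightarrow> real) \<Rightarrow> real" where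
  "query_fun i dbar m n D q =
     (case i of
        CountQ \<Rightarrow> real (card {k \<in> {..<n}. matches dbar (D k) q})
      | SumQ \<Rightarrow> (\<Sum>k \<in> {k \<in> {..<n}. matches dbar (D k) q}. D k m))"

definition unit_cube :: "nat \<Rightarrow> (nat \<Rightarrow> real) set" where
  "unit_cube k = PiE {..<k} (\<lambda>_. {0..1})"

definition query_space :: "nat \<Rightarrow> (nat \<Rightarrow> real) set" where
  "query_space dbar = {q \<in> unit_cube (2 * dbar). \<forall>j<dbar. q j + q (dbar + j) \<le> 1}"

definition lebesgue_k :: "nat \<Rightarrow> (nat \<Rightarrow> real) measure" where
  "lebesgue_k k = PiM {..<k} (\<lambda>_. lborel)"

definition L1_Q :: "nat \<Rightarrow> ((nat \<Rightarrow> real) \<Rightarrow> real) \<Rightarrow> ((nat \<Rightarrow> real) \<Rightarrow> real) \<Rightarrow> ennreal" where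
  "L1_Q dbar g h = (\<integral>\<^sup>+ q. indicator (query_space dbar) q * ennreal \<bar>g q - h q\<bar> \<partial>lebesgue_k (2 * dbar))"

definition db_measure :: "(nat \<Rightarrow> real) measure \<Rightarrow> nat \<Rightarrow> (nat \<Rightarrow> nat \<Rightarrow> real) measure" where
  "db_measure Chi n = PiM {..<n} (\<lambda>_. Chi)"

definition dist_query_fun ::
  "agg \<Rightarrow> nat \<Rightarrow> nat \<Rightarrow> (nat \<Rightarrow> real) measure \<Rightarrow> nat \<Rightarrow> (nat \<Rightarrow> real) \<Rightarrow> real" where
  "dist_query_fun i dbar m Chi n q =
     (1 / real n) * (\<integral>D. query_fun i dbar m n D q \<partial>db_measure Chi n)"

definition l1_dist :: "nat \<Rightarrow> (nat \<Rightarrow> real) \<Rightarrow> (nat \<Rightarrow> real) \<Rightarrow> real" where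
  "l1_dist k x y = (\<Sum>j<k. \<bar>x j - y j\<bar>)"

definition l1_lipschitz_on ::
  "nat \<Rightarrow> real \<Rightarrow> (nat \<Rightarrow> real) set \<Rightarrow> ((nat \<Rightarrow> real) \<Rightarrow> real) \<Rightarrow> bool" where
  "l1_lipschitz_on k \<rho> S g \<longleftrightarrow> (\<forall>x\<in>S. \<forall>y\<in>S. \<bar>g x - g y\<bar> \<le> \<rho> * l1_dist k x y)"

definition l1_lipschitz_const ::
  "nat \<Rightarrow> (nat \<Rightarrow> real) set \<Rightarrow> ((nat \<Rightarrow> real) \<Rightarrow> real) \<Rightarrow> real" where
  "l1_lipschitz_const k S g = Inf {\<rho>. 0 \<le> \<rho> \<and> l1_lipschitz_on k \<rho> S g}"

text \<open>A layer is (W, b): W is a list of rows (one per output neuron), b the biases.\<close>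
type_synonym layer = "rat list list \<times> rat list"

definition relu :: "real \<Rightarrow> real" where
  "relu x = max 0 x"

definition affine :: "layer \<Rightarrow> real list \<Rightarrow> real list" where
  "affine L x = map2 (\<lambda>w b. sum_list (map2 (\<lambda>a y. real_of_rat a * y) w x) + real_of_rat b)
                     (fst L) (snd L)"

fun nn_eval :: "layer list \<Rightarrow> real list \<Rightarrow> real list" where
  "nn_eval [] x = x"
| "nn_eval [L] x = affine L x"
| "nn_eval (L # L' # Ls) x = nn_eval (L' # Ls) (map relu (affine L x))"

fun nn_wf :: "nat \<Rightarrow> layer list \<Rightarrow> bool" where
  "nn_wf k [] = (k = 1)"
| "nn_wf k (L # Ls) = (length (snd L) = length (fst L) \<and> (\<forall>w \<in> set (fst L). length w = k)
                        \<and> nn_wf (length (fst L)) Ls)"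

definition nn_fun :: "nat \<Rightarrow> layer list \<Rightarrow> (nat \<Rightarrow> real) \<Rightarrow> real" where
  "nn_fun d N q = hd (nn_eval N (map q [0..<d]))"

definition int_bits :: "int \<Rightarrow> nat" where
  "int_bits z = (if z = 0 then 1 else nat \<lfloor>log 2 \<bar>z\<bar>\<rfloor> + 2)"

definition rat_bits :: "rat \<Rightarrow> nat" where
  "rat_bits r = (case quotient_of r of (a, b) \<Rightarrow> int_bits a + int_bits b)"

definition nn_space :: "layer list \<Rightarrow> nat" where
  "nn_space N = (\<Sum>L\<leftarrow>N. (\<Sum>w\<leftarrow>fst L. \<Sum>a\<leftarrow>w. rat_bits a) + (\<Sum>a\<leftarrow>snd L. rat_bits a))"

text \<open>Query time: operations of a forward pass (per neuron: one multiplication and one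
  addition per weight, the bias addition, and one ReLU).\<close>
definition nn_time :: "layer list \<Rightarrow> nat" where
  "nn_time N = (\<Sum>L\<leftarrow>N. (\<Sum>w\<leftarrow>fst L. 2 * length w + 2))"

end

theory Submission
  imports Defs
begin

text \<open>Let F(q) be the expected contribution of a single point of the database, so that the query
  function of D divided by n is an average of n i.i.d. terms with mean F(q).

  Approximation. F has values in [0,1], vanishes at the zero query, and is \<rho>-Lipschitz. If
  \<rho> d \<le> \<epsilon>1 or \<epsilon>1 \<ge> 1, the zero network is good enough. Otherwise let v run through a grid with
  t + 1 points per axis, t of order \<rho> d / \<epsilon>1, and consider the maximum of 0 and of the cones
  F(v) - \<rho> |q - v| with \<rho> and F(v) rounded to rationals. A ReLU network that is deep and narrow
  computes it by maintaining a running maximum, with two layers of width O(d) per grid point; unlike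
  a shallow network it has O(d^2) weights per grid point, and one factor d is absorbed by
  d \<le> 2^d when \<kappa>1 is doubled.

  Concentration. By Hoeffding's lemma the deviation at a fixed query has a subgaussian exponential
  moment. Integrating over q transfers the bound to the L1 deviation without any union bound, and gives
  the tail 2 exp (- 2 n \<epsilon>2^2). For \<epsilon>2 \<le> 1 this is stronger than the claim, and for \<epsilon>2 > 1 the
  deviation almost surely does not reach \<epsilon>2.\<close>

section \<open>Networks computing maxima of cones\<close>

definition mk_layer :: "nat \<Rightarrow> nat \<Rightarrow> (nat \<Rightarrow> nat \<Rightarrow> rat) \<Rightarrow> (nat \<Rightarrow> rat) \<Rightarrow> layer" where
  "mk_layer h k w b = (map (\<lambda>i. map (w i) [0..<k]) [0..<h], map b [0..<h])"

lemma affine_mk_layer: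
  "affine (mk_layer h k w b) (map y [0..<k])
     = map (\<lambda>i. (\<Sum>j<k. real_of_rat (w i j) * y j) + real_of_rat (b i)) [0..<h]"
  by (simp add: affine_def mk_layer_def map2_map_map interv_sum_list_conv_sum_set_nat
      atLeast0LessThan)

lemma sum_lessThan_add:
  fixes f :: "nat \<Rightarrow> 'a::comm_monoid_add"
  shows "sum f {..<m + n} = sum f {..<m} + (\<Sum>j<n. f (m + j))"
  by (induction n) (simp_all add: add.assoc)

text \<open>The state of the computation is the input x, the current maximum a + r, and the
  increment r still to be merged into it; all entries are nonnegative, so ReLU carries them.\<close>

definition state :: "nat \<Rightarrow> (nat \<Rightarrow> real) \<Rightarrow> real \<Rightarrow> real \<Rightarrow> real list" where
  "state d x a r = map (\<lambda>j. if j < d then x j else if j = d then a else r) [0..<d + 2]"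

text \<open>The rows \<open>d\<close> and \<open>d + 1\<close> are zero because the columns stop
  before \<open>d\<close>; the state thus starts with maximum and increment 0.\<close>

definition init_layer :: "nat \<Rightarrow> layer" where
  "init_layer d = mk_layer (d + 2) d (\<lambda>i j. of_bool (j = i)) (\<lambda>_. 0)"

text \<open>Four blocks of neurons: the copied input, the positive parts of x - v, the positive
  parts of v - x, and one neuron that merges the pending increment into the maximum, giving
  \<open>a + r\<close>.\<close>

definition dist_layer :: "nat \<Rightarrow> (nat \<Rightarrow> rat) \<Rightarrow> layer" where
  "dist_layer d v = mk_layer (3 * d + 1) (d + 2)
     (\<lambda>i j. if i < d then of_bool (j = i) else if i < 2 * d then of_bool (j = i - d)
            else if i < 3 * d then - of_bool (j = i - 2 * d) else of_bool (d \<le> j))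
     (\<lambda>i. if i < d then 0 else if i < 2 * d then - v (i - d)
          else if i < 3 * d then v (i - 2 * d) else 0)"

text \<open>The weights \<open>- \<rho>\<close> on both blocks of positive parts add up to
  \<open>- \<rho>\<close> times the distance from x to v. The last neuron therefore holds the amount
  by which the new cone exceeds the current maximum, or 0 after ReLU.\<close>

definition max_layer :: "nat \<Rightarrow> rat \<Rightarrow> rat \<Rightarrow> layer" where
  "max_layer d \<rho> \<phi> = mk_layer (d + 2) (3 * d + 1)
     (\<lambda>i j. if i < d then of_bool (j = i) else if i = d then of_bool (j = 3 * d)
            else if j < d then 0 else if j < 3 * d then - \<rho> else - 1)
     (\<lambda>i. if i \<le> d then 0 else \<phi>)"

text \<open>Merges the last pending increment and rescales by \<open>c\<close>; in the application
  \<open>c\<close> is the size of the database.\<close>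

definition out_layer :: "nat \<Rightarrow> rat \<Rightarrow> layer" where
  "out_layer d c = mk_layer 1 (d + 2) (\<lambda>i j. if d \<le> j then c else 0) (\<lambda>_. 0)"

fun cone_layers :: "nat \<Rightarrow> rat \<Rightarrow> rat \<Rightarrow> ((nat \<Rightarrow> rat) \<times> rat) list \<Rightarrow> layer list" where
  "cone_layers d c \<rho> [] = [out_layer d c]"
| "cone_layers d c \<rho> ((v, \<phi>) # ps) = dist_layer d v # max_layer d \<rho> \<phi> # cone_layers d c \<rho> ps"

definition cone_net :: "nat \<Rightarrow> rat \<Rightarrow> rat \<Rightarrow> ((nat \<Rightarrow> rat) \<times> rat) list \<Rightarrow> layer list" where
  "cone_net d c \<rho> ps = init_layer d # cone_layers d c \<rho> ps"

text \<open>The accumulator \<open>s\<close> mirrors the sum \<open>a + r\<close> of the network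
  state, so that an induction over the cones follows the layers.\<close>

fun cone_max :: "nat \<Rightarrow> real \<Rightarrow> ((nat \<Rightarrow> real) \<times> real) list \<Rightarrow> (nat \<Rightarrow> real) \<Rightarrow> real \<Rightarrow> real" where
  "cone_max d \<rho> [] x s = s"
| "cone_max d \<rho> ((v, \<phi>) # ps) x s = cone_max d \<rho> ps x (max s (\<phi> - \<rho> * l1_dist d x v))"

lemma cone_layers_nonempty [simp]: "cone_layers d c \<rho> ps \<noteq> []"
  by (induction d c \<rho> ps rule: cone_layers.induct) auto

lemma nn_eval_Cons: "Ls \<noteq> [] \<Longrightarrow> nn_eval (L # Ls) x = nn_eval Ls (map relu (affine L x))"
  by (cases Ls) auto

lemma eval_init_layer:
  assumes "\<And>j. j < d \<Longrightarrow> 0 \<le> x j"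
  shows "map relu (affine (init_layer d) (map x [0..<d])) = state d x 0 0"
  using assms
  by (auto simp: init_layer_def affine_mk_layer state_def relu_def of_bool_def
      if_distrib[of real_of_rat] if_distrib[of "\<lambda>a. a * _"] cong: if_cong)

lemma eval_dist_layer:
  assumes "\<And>j. j < d \<Longrightarrow> 0 \<le> x j" "0 \<le> a" "0 \<le> r"
  shows "map relu (affine (dist_layer d v) (state d x a r))
    = map (\<lambda>i. if i < d then x i else if i < 2 * d then relu (x (i - d) - real_of_rat (v (i - d)))
        else if i < 3 * d then relu (real_of_rat (v (i - 2 * d)) - x (i - 2 * d)) else a + r) [0..<3 * d + 1]"
proof -
  define y where "y j = (if j < d then x j else if j = d then a else r)" for j
  define k where "k = d + 2"
  have delta: "(\<Sum>j<k. real_of_rat (of_bool (j = l)) * y j) = x l"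
    "(\<Sum>j<k. real_of_rat (- of_bool (j = l)) * y j) = - x l" if "l < d" for l
    using that by (auto simp: of_bool_def y_def k_def of_rat_minus
      if_distrib[of real_of_rat] if_distrib[of uminus] if_distrib[of "\<lambda>a. a * _"] cong: if_cong)
  have tail: "(\<Sum>j<k. real_of_rat (of_bool (d \<le> j)) * y j) = a + r"
    by (simp add: k_def y_def)
  show ?thesis
    unfolding dist_layer_def state_def y_def[symmetric] k_def[symmetric] affine_mk_layer map_map
  proof (intro map_cong refl, goal_cases)
    case (1 i)
    consider "i < d" | "d \<le> i" "i < 2 * d" | "2 * d \<le> i" "i < 3 * d" | "i = 3 * d" using 1 by force
    then show ?case
      using assms by cases (auto simp: delta tail relu_def, auto simp: of_rat_minus)
  qed
qed

lemma relu_add_relu: "relu x + relu (- x) = \<bar>x\<bar>"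
  by (auto simp: relu_def)

lemma eval_max_layer:
  assumes "\<And>j. j < d \<Longrightarrow> 0 \<le> x j" "0 \<le> a" "0 \<le> r"
  shows "map relu (affine (max_layer d \<rho> \<phi>) (map relu (affine (dist_layer d v) (state d x a r))))
    = state d x (a + r) (relu (real_of_rat \<phi> - real_of_rat \<rho> * l1_dist d x (\<lambda>j. real_of_rat (v j)) - (a + r)))"
proof -
  define y where "y i = (if i < d then x i else if i < 2 * d then relu (x (i - d) - real_of_rat (v (i - d)))
        else if i < 3 * d then relu (real_of_rat (v (i - 2 * d)) - x (i - 2 * d)) else a + r)" for i
  define k where "k = 3 * d + 1"
  have layer1: "map relu (affine (dist_layer d v) (state d x a r)) = map y [0..<k]"
    unfolding y_def k_def by (rule eval_dist_layer) (use assms in auto)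
  have delta: "(\<Sum>j<k. real_of_rat (of_bool (j = l)) * y j) = y l" if "l < k" for l
    using that by (auto simp: of_bool_def
      if_distrib[of real_of_rat] if_distrib[of "\<lambda>a. a * _"] cong: if_cong)
  \<comment> \<open>The blocks are the copied input, the positive parts, the negative parts and the
    merged maximum.\<close>
  have split: "{..<k} = {..<d + (d + (d + 1))}" by (auto simp: k_def algebra_simps)
  have yd: "y (d + j) = relu (x j - real_of_rat (v j))"
    "y (d + (d + j)) = relu (- (x j - real_of_rat (v j)))" if "j < d" for j
    using that by (auto simp: y_def mult_2)
  have "(\<Sum>j<k. real_of_rat (if j < d then 0 else if j < 3 * d then - \<rho> else - 1) * y j)
      = (\<Sum>j<d. - real_of_rat \<rho> * relu (x j - real_of_rat (v j)))
        + ((\<Sum>j<d. - real_of_rat \<rho> * relu (- (x j - real_of_rat (v j)))) - (a + r))"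
    unfolding split sum_lessThan_add
    by (simp add: yd of_rat_minus) (simp add: y_def)
  also have "\<dots> = - real_of_rat \<rho> * l1_dist d x (\<lambda>j. real_of_rat (v j)) - (a + r)"
    by (simp add: l1_dist_def relu_add_relu[symmetric] sum_distrib_left sum.distrib[symmetric]
        sum_negf[symmetric] algebra_simps)
  finally have dist: "(\<Sum>j<k. real_of_rat (if j < d then 0 else if j < 3 * d then - \<rho> else - 1) * y j)
     = - real_of_rat \<rho> * l1_dist d x (\<lambda>j. real_of_rat (v j)) - (a + r)" .
  show ?thesis
    unfolding layer1
    unfolding max_layer_def state_def y_def[symmetric] k_def[symmetric] affine_mk_layer map_map
  proof (intro map_cong refl, goal_cases)
    case (1 i)
    consider "i < d" | "i = d" | "i = d + 1" using 1 by force
    then show ?case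
    proof cases
      case 3
      then show ?thesis by (simp add: comp_def dist) (simp add: algebra_simps)
    qed (use assms delta[of i] delta[of "3 * d"] in \<open>auto simp: relu_def y_def k_def\<close>)
  qed
qed

lemma eval_out_layer:
  "affine (out_layer d c) (state d x a r) = [real_of_rat c * (a + r)]"
  unfolding out_layer_def state_def affine_mk_layer
  by (simp add: numeral_2_eq_2 distrib_left)

lemma nn_eval_cone_layers:
  assumes "\<And>j. j < d \<Longrightarrow> 0 \<le> x j" "0 \<le> a" "0 \<le> r"
  shows "nn_eval (cone_layers d c \<rho> ps) (state d x a r)
    = [real_of_rat c * cone_max d (real_of_rat \<rho>)
         (map (\<lambda>(v, \<phi>). (\<lambda>j. real_of_rat (v j), real_of_rat \<phi>)) ps) x (a + r)]"
  using assms(2,3)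
proof (induction ps arbitrary: a r)
  case Nil
  then show ?case by (simp add: eval_out_layer)
next
  case (Cons p ps)
  obtain v \<phi> where p: "p = (v, \<phi>)" by (cases p)
  \<comment> \<open>Adding the increment amounts to taking a maximum. One layer can form
    \<open>relu (t - s)\<close>, but the sum with \<open>s\<close> has to wait for the next layer;
    hence the two entries in the state.\<close>
  have "a + r + relu (t - (a + r)) = max (a + r) t" for t by (auto simp: relu_def)
  with Cons show ?case
    by (simp add: p nn_eval_Cons eval_max_layer[OF assms(1)] relu_def[of "_ - _"])
qed

lemma nn_fun_cone_net:
  assumes "\<And>j. j < d \<Longrightarrow> 0 \<le> x j"
  shows "nn_fun d (cone_net d c \<rho> ps) x
    = real_of_rat c * cone_max d (real_of_rat \<rho>)
         (map (\<lambda>(v, \<phi>). (\<lambda>j. real_of_rat (v j), real_of_rat \<phi>)) ps) x 0"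
  using nn_eval_cone_layers[OF assms, where a=0 and r=0] assms
  by (simp add: nn_fun_def cone_net_def nn_eval_Cons eval_init_layer)

lemma cone_max_le:
  assumes "s \<le> u" "\<And>v \<phi>. (v, \<phi>) \<in> set ps \<Longrightarrow> \<phi> - \<rho> * l1_dist d x v \<le> u"
  shows "cone_max d \<rho> ps x s \<le> u"
  using assms by (induction d \<rho> ps x s rule: cone_max.induct) auto

lemma cone_max_ge_start: "s \<le> cone_max d \<rho> ps x s"
  by (induction d \<rho> ps x s rule: cone_max.induct) auto

lemma cone_max_ge:
  assumes "(v, \<phi>) \<in> set ps"
  shows "\<phi> - \<rho> * l1_dist d x v \<le> cone_max d \<rho> ps x s"
  using assms
proof (induction d \<rho> ps x s rule: cone_max.induct)
  case (2 d \<rho> v' \<phi>' ps x s)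
  then show ?case
    using cone_max_ge_start[of "max s (\<phi>' - \<rho> * l1_dist d x v')" d \<rho> ps x] by auto
qed auto

section \<open>Counting parameters and bits\<close>

definition nn_size :: "layer list \<Rightarrow> nat" where
  "nn_size N = (\<Sum>L\<leftarrow>N. \<Sum>w\<leftarrow>fst L. length w + 1)"

lemma nn_time_eq: "nn_time N = 2 * nn_size N"
  by (simp add: nn_time_def nn_size_def sum_list_const_mult[symmetric] distrib_left)

lemma sum_list_le_length:
  fixes f :: "'a \<Rightarrow> nat"
  assumes "\<And>a. a \<in> set xs \<Longrightarrow> real (f a) \<le> \<beta>"
  shows "real (\<Sum>a\<leftarrow>xs. f a) \<le> \<beta> * real (length xs)"
  using assms by (induction xs) (auto simp: algebra_simps intro: add_mono)

definition params :: "layer \<Rightarrow> rat set" where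
  "params L = (\<Union>w\<in>set (fst L). set w) \<union> set (snd L)"

text \<open>Well-formedness gives every row exactly one bias, so \<open>nn_size\<close> counts all
  parameters, each of which costs at most \<open>\<beta>\<close> bits.\<close>

lemma nn_space_le:
  assumes "nn_wf k N" "\<And>L a. L \<in> set N \<Longrightarrow> a \<in> params L \<Longrightarrow> real (rat_bits a) \<le> \<beta>"
  shows "real (nn_space N) \<le> \<beta> * real (nn_size N)"
  using assms
proof (induction k N rule: nn_wf.induct)
  case (2 k L Ls)
  have rows: "real (\<Sum>w\<leftarrow>ws. \<Sum>a\<leftarrow>w. rat_bits a) \<le> \<beta> * real (\<Sum>w\<leftarrow>ws. length w)"
    if "\<And>w a. w \<in> set ws \<Longrightarrow> a \<in> set w \<Longrightarrow> real (rat_bits a) \<le> \<beta>" for ws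
    using that
  proof (induction ws)
    case (Cons w ws)
    show ?case
      using Cons.IH Cons.prems sum_list_le_length[of w rat_bits \<beta>] by (force simp: distrib_left)
  qed simp
  have "real (\<Sum>w\<leftarrow>fst L. \<Sum>a\<leftarrow>w. rat_bits a) \<le> \<beta> * real (\<Sum>w\<leftarrow>fst L. length w)"
    using "2.prems"(2)[of L] by (intro rows) (auto simp: params_def)
  moreover have "real (\<Sum>a\<leftarrow>snd L. rat_bits a) \<le> \<beta> * real (length (snd L))"
    using "2.prems"(2)[of L] by (intro sum_list_le_length) (auto simp: params_def)
  moreover have "real (nn_space Ls) \<le> \<beta> * real (nn_size Ls)"
    using 2 by auto
  moreover have "(\<Sum>w\<leftarrow>ws. length w + 1) = (\<Sum>w\<leftarrow>ws. length w) + length ws" for ws :: "rat list list"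
    by (induction ws) auto
  ultimately show ?case
    using "2.prems"(1) by (simp add: nn_space_def nn_size_def distrib_left)
qed (simp add: nn_space_def nn_size_def)

lemma nn_size_simps:
  "nn_size [] = 0" "nn_size (mk_layer h k w b # Ls) = h * (k + 1) + nn_size Ls"
  by (simp_all add: nn_size_def mk_layer_def comp_def sum_list_triv)

lemma nn_wf_mk_layer: "nn_wf k (mk_layer h k w b # Ls) \<longleftrightarrow> nn_wf h Ls"
  by (auto simp: mk_layer_def)

lemma nn_wf_cone_net: "nn_wf d (cone_net d c \<rho> ps)"
proof -
  have "nn_wf (d + 2) (cone_layers d c \<rho> ps)"
    by (induction d c \<rho> ps rule: cone_layers.induct)
      (simp_all only: cone_layers.simps dist_layer_def max_layer_def out_layer_def nn_wf_mk_layer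
        nn_wf.simps(1))
  then show ?thesis
    by (simp only: cone_net_def init_layer_def nn_wf_mk_layer)
qed

text \<open>Each cone costs two layers with O(d) rows of length O(d); \<open>2 \<le> d\<close> lets
  \<open>d ^ 2\<close> swallow the lower-order terms.\<close>

lemma nn_size_cone_net:
  assumes "2 \<le> d"
  shows "nn_size (cone_net d c \<rho> ps) \<le> (20 * length ps + 8) * d ^ 2"
proof -
  have "nn_size (cone_layers d c \<rho> ps)
      = length ps * ((3 * d + 1) * (d + 3) + (d + 2) * (3 * d + 2)) + (d + 3)"
    by (induction d c \<rho> ps rule: cone_layers.induct)
      (simp_all add: dist_layer_def max_layer_def out_layer_def nn_size_simps algebra_simps)
  moreover have "(3 * d + 1) * (d + 3) + (d + 2) * (3 * d + 2) \<le> (4 * d) * (3 * d) + (2 * d) * (4 * d)"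
    using assms by (intro add_mono mult_mono) auto
  moreover have "(d + 2) * (d + 1) \<le> (2 * d) * (2 * d)"
    using assms by (intro mult_mono) auto
  moreover have "d + 3 \<le> 4 * (d * d)"
    using assms mult_mono[of 1 d 1 d] mult_right_mono[of 1 d d] by linarith
  ultimately have "nn_size (cone_net d c \<rho> ps)
      \<le> (2 * d) * (2 * d) + length ps * ((4 * d) * (3 * d) + (2 * d) * (4 * d)) + 4 * (d * d)"
    unfolding cone_net_def init_layer_def nn_size_simps
    by (metis (no_types, lifting) add.assoc add_mono mult_le_mono2)
  also have "\<dots> = (20 * length ps + 8) * d ^ 2"
    by (simp add: power2_eq_square algebra_simps)
  finally show ?thesis .
qed

lemma params_mk_layer:
  assumes "\<And>i j. i < h \<Longrightarrow> j < k \<Longrightarrow> w i j \<in> A" "\<And>i. i < h \<Longrightarrow> b i \<in> A"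
  shows "params (mk_layer h k w b) \<subseteq> A"
  using assms by (auto simp: params_def mk_layer_def)

text \<open>The bit length has to be bounded only on this set. Apex coordinates occur with both
  signs because they are the biases for x - v and for v - x.\<close>

lemma params_cone_net:
  assumes "L \<in> set (cone_net d c \<rho> ps)"
  shows "params L \<subseteq> {0, 1, - 1, c, - \<rho>} \<union> (\<Union>(v, \<phi>)\<in>set ps. insert \<phi> (v ` {..<d} \<union> uminus ` v ` {..<d}))"
proof -
  have "params L \<subseteq> {0, 1, - 1, c, - \<rho>} \<union> (\<Union>(v, \<phi>)\<in>set ps. insert \<phi> (v ` {..<d} \<union> uminus ` v ` {..<d}))"
    if "L \<in> set (cone_layers d c \<rho> ps)" for L
    using that
  proof (induction d c \<rho> ps rule: cone_layers.induct)
    case (1 d c \<rho>)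
    then have L: "L = out_layer d c" by simp
    show ?case unfolding L out_layer_def by (rule params_mk_layer) auto
  next
    case (2 d c \<rho> v \<phi> ps)
    then consider "L = dist_layer d v" | "L = max_layer d \<rho> \<phi>" | "L \<in> set (cone_layers d c \<rho> ps)"
      by auto
    then show ?case
    proof cases
      case 1
      show ?thesis unfolding 1 dist_layer_def by (rule params_mk_layer) auto
    next
      case 2
      show ?thesis unfolding 2 max_layer_def by (rule params_mk_layer) auto
    next
      case 3
      then show ?thesis using "2.IH" by auto
    qed
  qed
  moreover have "params (init_layer d) \<subseteq> {0, 1}"
    unfolding init_layer_def by (rule params_mk_layer) auto
  ultimately show ?thesis
    using assms unfolding cone_net_def set_simps insert_iff by blast
qed

lemma int_bits_le:
  assumes "\<bar>real_of_int z\<bar> \<le> H" "1 \<le> H"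
  shows "real (int_bits z) \<le> log 2 H + 2"
proof (cases "z = 0")
  case False
  then have "log 2 \<bar>real_of_int z\<bar> \<le> log 2 H" using assms by simp
  moreover have "0 \<le> log 2 \<bar>real_of_int z\<bar>" using False by simp
  ultimately show ?thesis
    using False by (simp add: int_bits_def) linarith
qed (use assms in \<open>simp add: int_bits_def\<close>)

text \<open>\<open>quotient_of\<close> yields the reduced fraction, and cancelling the gcd only
  shrinks numerator and denominator; so any representation with entries up to \<open>H\<close> will
  do.\<close>

lemma rat_bits_le:
  assumes "r = of_int a / of_int b" "0 < b" "\<bar>real_of_int a\<bar> \<le> H" "real_of_int b \<le> H"
  shows "real (rat_bits r) \<le> 2 * (log 2 H + 2)"
proof -
  let ?g = "gcd a b"
  have g: "?g \<ge> 1" using assms(2) by (simp add: int_one_le_iff_zero_less)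
  have q: "quotient_of r = (a div ?g, b div ?g)"
    using assms(1,2) by (simp add: Fract_of_int_quotient[symmetric] quotient_of_Fract normalize_def Let_def)
  have div_le: "\<bar>z div ?g\<bar> \<le> \<bar>z\<bar>" if dvd: "?g dvd z" for z
  proof -
    obtain y where "z = ?g * y" using dvd by (elim dvdE)
    moreover have "1 * \<bar>y\<bar> \<le> ?g * \<bar>y\<bar>" using g by (intro mult_right_mono) auto
    ultimately show ?thesis using g by (metis abs_mult abs_of_nonneg gcd_ge_0_int mult_1 nonzero_mult_div_cancel_left not_one_le_zero)
  qed
  have H: "1 \<le> H" using assms(2,4) by linarith
  have "\<bar>real_of_int (a div ?g)\<bar> \<le> H"
    using order_trans[OF of_int_le_iff[THEN iffD2, OF div_le[of a]] assms(3)[folded of_int_abs]] by simp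
  then have "real (int_bits (a div ?g)) \<le> log 2 H + 2"
    by (rule int_bits_le[OF _ H])
  moreover have "\<bar>real_of_int (b div ?g)\<bar> \<le> H"
    using order_trans[OF of_int_le_iff[THEN iffD2, OF div_le[of b]], of H] assms(2,4) by simp
  then have "real (int_bits (b div ?g)) \<le> log 2 H + 2"
    by (rule int_bits_le[OF _ H])
  ultimately show ?thesis by (simp add: rat_bits_def q)
qed

lemma measurable_cone_max:
  assumes "\<And>j. j < d \<Longrightarrow> (\<lambda>x. f x j) \<in> borel_measurable M" "s \<in> borel_measurable M"
  shows "(\<lambda>x. cone_max d \<rho> ps (f x) (s x)) \<in> borel_measurable M"
  using assms(2)
proof (induction ps arbitrary: s)
  case (Cons p ps)
  have [measurable]: "(\<lambda>x. l1_dist d (f x) v) \<in> borel_measurable M" for v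
    unfolding l1_dist_def by (intro borel_measurable_sum borel_measurable_abs borel_measurable_diff)
      (use assms in auto)
  note [measurable] = Cons.prems
  obtain v \<phi> where p: "p = (v, \<phi>)" by (cases p)
  show ?case
    unfolding p cone_max.simps by (rule Cons.IH) measurable
qed simp

section \<open>Approximating a Lipschitz function by cones over a grid\<close>

lemma l1_dist_nonneg: "0 \<le> l1_dist d x y"
  by (simp add: l1_dist_def sum_nonneg)

text \<open>The maximum of the cones with apices on the graph of G is McShane's extension of the
  restriction of G to the set of apices.\<close>

lemma cone_max_approx:
  assumes G: "l1_lipschitz_on d \<rho> S G" and q: "q \<in> S" and \<rho>: "0 \<le> \<rho>" and G0: "0 \<le> G q"
    and ps: "\<And>v \<phi>. (v, \<phi>) \<in> set ps \<Longrightarrow>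
      restrict v {..<d} \<in> S \<and> G (restrict v {..<d}) - \<eta> \<le> \<phi> \<and> \<phi> \<le> G (restrict v {..<d})"
    and near: "(v0, \<phi>0) \<in> set ps" "l1_dist d q v0 \<le> \<delta>"
  shows "\<bar>cone_max d \<rho> ps q 0 - G q\<bar> \<le> \<eta> + 2 * \<rho> * \<delta>"
proof -
  have restrict: "l1_dist d q (restrict v {..<d}) = l1_dist d q v" for v
    by (simp add: l1_dist_def)
  have lip: "\<bar>G q - G (restrict v {..<d})\<bar> \<le> \<rho> * l1_dist d q v" if "(v, \<phi>) \<in> set ps" for v \<phi>
    using G q ps[OF that] unfolding restrict[of v, symmetric] l1_lipschitz_on_def by blast
  have "cone_max d \<rho> ps q 0 \<le> G q"
  proof (rule cone_max_le[OF G0])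
    fix v \<phi> assume "(v, \<phi>) \<in> set ps"
    then show "\<phi> - \<rho> * l1_dist d q v \<le> G q" using lip[of v \<phi>] ps[of v \<phi>] by linarith
  qed
  \<comment> \<open>At the near apex, the slope of the cone and the variation of \<open>G\<close>
    between \<open>q\<close> and the apex each lose at most
    \<open>\<rho> * \<delta>\<close>.\<close>
  moreover have "\<rho> * l1_dist d q v0 \<le> \<rho> * \<delta>" using near \<rho> by (intro mult_left_mono)
  then have "G q - (\<eta> + 2 * \<rho> * \<delta>) \<le> cone_max d \<rho> ps q 0"
    using cone_max_ge[OF near(1), of \<rho> d q 0] ps[OF near(1)] lip[OF near(1)] by linarith
  moreover have "0 \<le> \<rho> * \<delta>" using near \<rho> l1_dist_nonneg[of d q v0] by simp
  moreover have "0 \<le> \<eta>" using ps[OF near(1)] by linarith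
  ultimately show ?thesis by linarith
qed

lemma grid_point_near:
  assumes q: "q \<in> unit_cube d" and t: "0 < t"
  shows "\<exists>us \<in> set (List.n_lists d [0..<t + 1]). l1_dist d q (\<lambda>j. real (us ! j) / real t) \<le> real d / real t"
proof
  \<comment> \<open>Rounding \<open>t * q j\<close> down moves the coordinate by at most
    \<open>1 / t\<close>, and \<open>q j \<le> 1\<close> keeps the index within
    \<open>t\<close>.\<close>
  define us where "us = map (\<lambda>j. nat \<lfloor>real t * q j\<rfloor>) [0..<d]"
  have q01: "0 \<le> q j" "q j \<le> 1" if "j < d" for j
    using q that by (auto simp: unit_cube_def PiE_iff)
  have "nat \<lfloor>real t * q j\<rfloor> \<le> t" if "j < d" for j
  proof -
    have "real t * q j \<le> real t * 1" using q01[OF that] by (intro mult_left_mono) auto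
    then show ?thesis by linarith
  qed
  then show "us \<in> set (List.n_lists d [0..<t + 1])"
    by (auto simp: set_n_lists us_def less_Suc_eq_le simp del: upt_Suc)
  have "\<bar>q j - real (us ! j) / real t\<bar> \<le> 1 / real t" if "j < d" for j
  proof -
    have "0 \<le> real t * q j" using q01[OF that] by simp
    then have "\<bar>real t * q j - real (us ! j)\<bar> \<le> 1"
      using that by (simp add: us_def) linarith
    moreover have "q j - real (us ! j) / real t = (real t * q j - real (us ! j)) / real t"
      using t by (simp add: field_simps)
    ultimately show ?thesis using t by (simp add: divide_right_mono)
  qed
  then have "(\<Sum>j<d. \<bar>q j - real (us ! j) / real t\<bar>) \<le> (\<Sum>j<d. 1 / real t)"
    by (intro sum_mono) auto
  then show "l1_dist d q (\<lambda>j. real (us ! j) / real t) \<le> real d / real t"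
    by (simp add: l1_dist_def)
qed

lemma n_lists_nth_le:
  assumes "us \<in> set (List.n_lists d [0..<t + 1])" "j < d"
  shows "us ! j \<le> t"
proof -
  have "length us = d" "set us \<subseteq> {0..<t + 1}"
    using assms by (auto simp: set_n_lists simp del: upt_Suc)
  then have "us ! j \<in> {0..<t + 1}"
    using assms(2) nth_mem[of j us] by blast
  then show ?thesis by simp
qed

lemma restrict_grid_point_in_unit_cube:
  assumes "us \<in> set (List.n_lists d [0..<t + 1])"
  shows "restrict (\<lambda>j. real (us ! j) / real t) {..<d} \<in> unit_cube d"
proof -
  have "us ! j \<le> t" if "j < d" for j
    using assms that by (rule n_lists_nth_le)
  then show ?thesis
    by (cases "t = 0") (auto simp: unit_cube_def PiE_iff)
qed

text \<open>Heights are rounded down to multiples of \<open>1 / K\<close>, which makes them rational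
  and keeps them below \<open>G\<close>. As \<open>unit_cube\<close> consists of extensional
  functions, a grid point is restricted before \<open>G\<close> is applied.\<close>

definition grid_cones :: "nat \<Rightarrow> nat \<Rightarrow> nat \<Rightarrow> ((nat \<Rightarrow> real) \<Rightarrow> real) \<Rightarrow> ((nat \<Rightarrow> rat) \<times> rat) list" where
  "grid_cones d t K G = map (\<lambda>us. (\<lambda>j. of_nat (us ! j) / of_nat t,
      of_int \<lfloor>real K * G (restrict (\<lambda>j. real (us ! j) / real t) {..<d})\<rfloor> / of_nat K))
    (List.n_lists d [0..<t + 1])"

lemma length_grid_cones: "length (grid_cones d t K G) = (t + 1) ^ d"
  by (simp add: grid_cones_def length_n_lists)

lemma cone_max_grid_cones_approx:
  assumes G: "l1_lipschitz_on d \<rho> (unit_cube d) G" and q: "q \<in> unit_cube d" and \<rho>: "0 \<le> \<rho>"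
    and G0: "0 \<le> G q" and t: "0 < t" and K: "0 < K"
  shows "\<bar>cone_max d \<rho> (map (\<lambda>(v, \<phi>). (\<lambda>j. real_of_rat (v j), real_of_rat \<phi>)) (grid_cones d t K G)) q 0 - G q\<bar>
    \<le> 1 / real K + 2 * \<rho> * (real d / real t)"
proof -
  let ?v = "\<lambda>us j. real (us ! j) / real t"
  let ?\<phi> = "\<lambda>us. real_of_int \<lfloor>real K * G (restrict (?v us) {..<d})\<rfloor> / real K"
  have ps: "map (\<lambda>(v, \<phi>). (\<lambda>j. real_of_rat (v j), real_of_rat \<phi>)) (grid_cones d t K G)
      = map (\<lambda>us. (?v us, ?\<phi> us)) (List.n_lists d [0..<t + 1])"
    by (simp add: grid_cones_def of_rat_divide)
  obtain us where us: "us \<in> set (List.n_lists d [0..<t + 1])" "l1_dist d q (?v us) \<le> real d / real t"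
    using grid_point_near[OF q t] by blast
  have \<phi>: "?\<phi> us \<le> G (restrict (?v us) {..<d}) \<and> G (restrict (?v us) {..<d}) - 1 / real K \<le> ?\<phi> us" for us
  proof -
    let ?g = "G (restrict (?v us) {..<d})"
    have "real_of_int \<lfloor>real K * ?g\<rfloor> / real K \<le> real K * ?g / real K"
      by (intro divide_right_mono) auto
    moreover have "(real K * ?g - 1) / real K \<le> real_of_int \<lfloor>real K * ?g\<rfloor> / real K"
      by (intro divide_right_mono) (linarith, simp)
    ultimately show ?thesis using K by (simp add: diff_divide_distrib)
  qed
  show ?thesis
    unfolding ps
  proof (rule cone_max_approx[OF G q \<rho> G0])
    show "(?v us, ?\<phi> us) \<in> set (map (\<lambda>us. (?v us, ?\<phi> us)) (List.n_lists d [0..<t + 1]))"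
      unfolding set_map by (rule imageI) (fact us(1))
    show "l1_dist d q (?v us) \<le> real d / real t" by fact
  next
    fix v \<phi> assume "(v, \<phi>) \<in> set (map (\<lambda>us. (?v us, ?\<phi> us)) (List.n_lists d [0..<t + 1]))"
    then obtain us' where us': "us' \<in> set (List.n_lists d [0..<t + 1])" "v = ?v us'" "\<phi> = ?\<phi> us'"
      by auto
    show "restrict v {..<d} \<in> unit_cube d \<and> G (restrict v {..<d}) - 1 / real K \<le> \<phi> \<and> \<phi> \<le> G (restrict v {..<d})"
      using restrict_grid_point_in_unit_cube[OF us'(1)] \<phi>[of us'] unfolding us'(2,3) by blast
  qed
qed

lemma int_frac_bits_le:
  assumes "a \<in> {of_int x / of_nat y | x y. \<bar>real_of_int x\<bar> \<le> H \<and> 0 < y \<and> real y \<le> H}"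
  shows "real (rat_bits a) \<le> 2 * (log 2 H + 2)"
proof -
  obtain x y where "a = of_int x / of_nat y" "\<bar>real_of_int x\<bar> \<le> H" "0 < y" "real y \<le> H"
    using assms by blast
  then show ?thesis using rat_bits_le[of a x "int y" H] by simp
qed

section \<open>Networks of the claimed size for a Lipschitz function on the cube\<close>

lemma zero_net:
  assumes "1 \<le> d"
  obtains N where "nn_wf d N" "\<And>q. nn_fun d N q = 0" "nn_space N \<le> 6 * d" "nn_time N \<le> 4 * d"
proof
  let ?N = "[mk_layer 1 d (\<lambda>_ _. 0) (\<lambda>_. 0)]"
  show wf: "nn_wf d ?N" by (simp only: nn_wf_mk_layer nn_wf.simps(1))
  show "nn_fun d ?N q = 0" for q
    by (simp only: nn_fun_def nn_eval.simps affine_mk_layer) simp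
  have size: "nn_size ?N \<le> 2 * d" using assms by (simp add: nn_size_simps)
  then show "nn_time ?N \<le> 4 * d" by (simp add: nn_time_eq)
  have "params L \<subseteq> {0}" if "L \<in> set ?N" for L
    using that params_mk_layer[of 1 d "\<lambda>_ _. 0" "{0}" "\<lambda>_. 0"] by simp
  \<comment> \<open>The rational 0 is stored as 0/1, which takes 1 + 2 bits.\<close>
  then have "real (rat_bits a) \<le> 3" if "L \<in> set ?N" "a \<in> params L" for L a
    using that by (auto simp: rat_bits_def int_bits_def)
  then have "real (nn_space ?N) \<le> 3 * real (nn_size ?N)" by (rule nn_space_le[OF wf])
  then show "nn_space ?N \<le> 6 * d" using size by linarith
qed

text \<open>On the cube, \<open>g\<close> is the network divided by \<open>n\<close>. It is named
  separately because the network is identified with a cone maximum only for nonnegative inputs,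
  whereas \<open>g\<close> is measurable on the whole space.\<close>

lemma exists_net_approx:
  fixes G :: "(nat \<Rightarrow> real) \<Rightarrow> real" and \<rho> \<epsilon> :: real and d n :: nat
  assumes d: "2 \<le> d" and n: "1 \<le> n" and \<epsilon>: "0 < \<epsilon>" and \<rho>: "0 \<le> \<rho>"
    and G: "l1_lipschitz_on d \<rho> (unit_cube d) G"
    and G01: "\<And>q. q \<in> unit_cube d \<Longrightarrow> 0 \<le> G q \<and> G q \<le> 1"
    and G0: "G (restrict (\<lambda>_. 0) {..<d}) = 0"
  defines "S \<equiv> real d * (20 * \<rho> * real d / \<epsilon> + 1) ^ d"
  defines "Y \<equiv> 2 + S + real n + 1 / \<epsilon>"
  shows "\<exists>N g. nn_wf d N \<and> real (nn_space N) \<le> 1000 * S * ln Y \<and> real (nn_time N) \<le> 1000 * S * ln Y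
    \<and> g \<in> borel_measurable (lebesgue_k d)
    \<and> (\<forall>q\<in>unit_cube d. nn_fun d N q = real n * g q \<and> \<bar>g q - G q\<bar> \<le> \<epsilon>)"
proof -
  define x where "x = \<rho> * real d / \<epsilon>"
  have x0: "0 \<le> x" using \<rho> \<epsilon> by (simp add: x_def)
  have S: "S = real d * (20 * x + 1) ^ d" by (simp add: S_def x_def mult.assoc)
  have "1 \<le> (20 * x + 1) ^ d" using x0 by (intro one_le_power) simp
  then have Sd: "real d \<le> S" unfolding S using mult_left_mono[of 1 "(20 * x + 1) ^ d" "real d"] by simp
  have Y4: "4 \<le> Y" unfolding Y_def using Sd d \<epsilon> by (simp add: add_increasing2)
  \<comment> \<open>\<open>Y \<ge> 4\<close> makes the logarithm at least 1, so that terms without a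
    logarithm also fit below \<open>S * ln Y\<close>.\<close>
  have "ln (4::real) = 2 * ln 2" using ln_realpow[of 2 2] by simp
  then have "1 \<le> ln (4::real)" using ln2_ge_two_thirds by simp
  moreover have "ln 4 \<le> ln Y" using Y4 by simp
  ultimately have lnY: "1 \<le> ln Y" by linarith
  have SlnY: "S \<le> S * ln Y" using lnY Sd mult_left_mono[of 1 "ln Y" S] by simp
  show ?thesis
  \<comment> \<open>The zero network works here: if \<open>x \<le> 1\<close>, going from the zero
    query to \<open>q\<close> changes \<open>G\<close> by at most
    \<open>\<rho> * d \<le> \<epsilon>\<close>, and if \<open>1 \<le> \<epsilon>\<close>, the range
    of \<open>G\<close> suffices.\<close>
  proof (cases "x \<le> 1 \<or> 1 \<le> \<epsilon>")
    case True
    obtain N where N: "nn_wf d N" "\<And>q. nn_fun d N q = 0" "nn_space N \<le> 6 * d" "nn_time N \<le> 4 * d"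
      using zero_net[of d] d by auto
    have "real d \<le> S * ln Y" using Sd SlnY by linarith
    then have "real (nn_space N) \<le> 1000 * S * ln Y" "real (nn_time N) \<le> 1000 * S * ln Y"
      using N(3,4) by linarith+
    moreover have "\<bar>0 - G q\<bar> \<le> \<epsilon>" if q: "q \<in> unit_cube d" for q
    proof (cases "1 \<le> \<epsilon>")
      case False
      have "restrict (\<lambda>_. 0) {..<d} \<in> unit_cube d" by (auto simp: unit_cube_def)
      then have "\<bar>G q - G (restrict (\<lambda>_. 0) {..<d})\<bar> \<le> \<rho> * l1_dist d q (restrict (\<lambda>_. 0) {..<d})"
        using G q unfolding l1_lipschitz_on_def by blast
      also have "l1_dist d q (restrict (\<lambda>_. 0) {..<d}) \<le> (\<Sum>j<d. 1)"
        unfolding l1_dist_def using q by (intro sum_mono) (auto simp: unit_cube_def PiE_iff)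
      then have "\<rho> * l1_dist d q (restrict (\<lambda>_. 0) {..<d}) \<le> \<rho> * real d"
        using \<rho> by (intro mult_left_mono) auto
      also have "\<rho> * real d \<le> \<epsilon>" using True False \<epsilon> by (simp add: x_def field_simps)
      finally show ?thesis by (simp add: G0)
    next
      case True
      then show ?thesis using G01[OF q] by simp
    qed
    ultimately show ?thesis
      using N(1,2) by (intro exI[of _ N] exI[of _ "\<lambda>_. 0"]) simp
  next
    case False
    then have x1: "1 < x" and \<epsilon>1: "\<epsilon> < 1" by auto
    \<comment> \<open>The rounded slope will be at most \<open>2 * \<rho>\<close>, so the grid error
      is at most \<open>4 * \<rho> * d / t\<close>; \<open>8 * x \<le> t\<close> brings it below
      \<open>\<epsilon> / 2\<close>.\<close>
    define t where "t = nat \<lceil>8 * x\<rceil>"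
    \<comment> \<open>\<open>1 / K \<le> \<epsilon> / (2 * d)\<close> serves twice: it keeps the
      rounding of the heights below \<open>\<epsilon> / 2\<close>, and, since
      \<open>\<epsilon> / (2 * d) \<le> \<rho>\<close> in this case, rounding the slope at most
      doubles it.\<close>
    define K where "K = 2 * d * nat \<lceil>1 / \<epsilon>\<rceil>"
    \<comment> \<open>The slope is rounded up, so that \<open>G\<close> stays Lipschitz for the
      rational slope \<open>R / K\<close>.\<close>
    define R where "R = \<lceil>\<rho> * real K\<rceil>"
    have t: "8 * x \<le> real t" "real t \<le> 8 * x + 1" using x1 unfolding t_def by linarith+
    then have t0: "0 < t" using x1 by (intro Nat.gr0I) auto
    have ceil: "1 / \<epsilon> \<le> real (nat \<lceil>1 / \<epsilon>\<rceil>)" "real (nat \<lceil>1 / \<epsilon>\<rceil>) \<le> 1 / \<epsilon> + 1"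
      using \<epsilon> by (simp_all add: ceiling_correct)
    have K: "2 * real d / \<epsilon> \<le> real K" "real K \<le> 2 * real d * (1 / \<epsilon> + 1)"
      using mult_left_mono[OF ceil(1), of "2 * real d"] mult_left_mono[OF ceil(2), of "2 * real d"]
      by (simp_all add: K_def)
    have "0 < 2 * real d / \<epsilon>" using d \<epsilon> by simp
    then have K0: "0 < K" using K(1) by (intro Nat.gr0I) auto
    have R: "\<rho> * real K \<le> R" "R \<le> \<rho> * real K + 1" unfolding R_def by linarith+
    define \<rho>' :: rat where "\<rho>' = of_int R / of_nat K"
    have \<rho>': "real_of_rat \<rho>' = R / real K" by (simp add: \<rho>'_def of_rat_divide)
    have \<rho>\<rho>': "\<rho> \<le> R / real K" using R(1) K0 by (simp add: field_simps)
    have "1 / real K \<le> 1 / (2 * real d / \<epsilon>)" using K(1) \<open>0 < 2 * real d / \<epsilon>\<close> by (intro frac_le) auto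
    then have K_inv: "1 / real K \<le> \<epsilon> / (2 * real d)" by simp
    have "\<epsilon> < \<rho> * real d" using x1 \<epsilon> by (simp add: x_def field_simps)
    then have "\<epsilon> / (2 * real d) \<le> \<rho>" using d \<epsilon> \<rho> by (simp add: field_simps)
    moreover have "R / real K \<le> \<rho> + 1 / real K" using R(2) K0 by (simp add: field_simps)
    ultimately have \<rho>'2: "R / real K \<le> 2 * \<rho>" using K_inv by linarith
    define cs where "cs = grid_cones d t K G"
    define cs' where "cs' = map (\<lambda>(v, \<phi>). (\<lambda>j. real_of_rat (v j), real_of_rat \<phi>)) cs"
    define N where "N = cone_net d (of_nat n) \<rho>' cs"
    define g where "g q = cone_max d (real_of_rat \<rho>') cs' q 0" for q
    have wf: "nn_wf d N" unfolding N_def by (rule nn_wf_cone_net)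

    have approx: "\<bar>g q - G q\<bar> \<le> \<epsilon>" if q: "q \<in> unit_cube d" for q
    proof -
      have "l1_lipschitz_on d (real_of_rat \<rho>') (unit_cube d) G"
        using G \<rho>\<rho>' unfolding l1_lipschitz_on_def \<rho>'
        by (meson l1_dist_nonneg mult_right_mono order_trans)
      then have "\<bar>g q - G q\<bar> \<le> 1 / real K + 2 * real_of_rat \<rho>' * (real d / real t)"
        unfolding g_def cs'_def cs_def
        using q G01[OF q] \<rho> \<rho>\<rho>' t0 K0 by (intro cone_max_grid_cones_approx) (auto simp: \<rho>')
      also have "\<dots> \<le> \<epsilon> / 2 + 4 * \<rho> * (real d / real t)"
      proof (rule add_mono)
        have "\<epsilon> / (2 * real d) \<le> \<epsilon> / (2 * 1)" using d \<epsilon> by (intro divide_left_mono) auto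
        then show "1 / real K \<le> \<epsilon> / 2" using K_inv by simp
        show "2 * real_of_rat \<rho>' * (real d / real t) \<le> 4 * \<rho> * (real d / real t)"
          using \<rho>'2 by (intro mult_right_mono) (auto simp: \<rho>')
      qed
      also have "4 * \<rho> * (real d / real t) \<le> \<epsilon> / 2"
      proof -
        have "8 * (\<rho> * real d) \<le> \<epsilon> * real t"
          using t(1) \<epsilon> by (simp add: x_def field_simps)
        then show ?thesis using t0 by (simp add: field_simps)
      qed
      finally show ?thesis by simp
    qed
    have net: "nn_fun d N q = real n * g q" if "q \<in> unit_cube d" for q
      using nn_fun_cone_net[of d q "of_nat n" \<rho>' cs] that
      by (simp add: N_def g_def cs'_def unit_cube_def PiE_iff)
    have meas: "g \<in> borel_measurable (lebesgue_k d)"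
      unfolding g_def by (rule measurable_cone_max)
        (auto simp: lebesgue_k_def intro!: measurable_component_singleton)

    \<comment> \<open>There are \<open>(t + 1) ^ d\<close> cones with O(d^2) weights each. With
      \<open>t + 1 \<le> 10 * x\<close>, the bound \<open>d \<le> 2 ^ d\<close> trades one factor
      \<open>d\<close> for doubling 10 to 20, the constant in \<open>S\<close>.\<close>
    have "real d * (real t + 1) ^ d \<le> 2 ^ d * (10 * x) ^ d"
    proof (rule mult_mono)
      show "real d \<le> 2 ^ d" using of_nat_less_two_power[of d, where 'a=real] by simp
      show "(real t + 1) ^ d \<le> (10 * x) ^ d" using t(2) x1 by (intro power_mono) linarith+
    qed simp_all
    also have "\<dots> = (20 * x) ^ d" unfolding power_mult_distrib[symmetric] by simp
    also have "\<dots> \<le> (20 * x + 1) ^ d" using x1 by (intro power_mono) auto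
    finally have "real d * (real d * (real t + 1) ^ d) \<le> S"
      unfolding S by (intro mult_left_mono) auto
    then have P: "real ((t + 1) ^ d * d ^ 2) \<le> S"
      by (simp add: power2_eq_square mult_ac add.commute)
    have "nn_size N \<le> (20 * (t + 1) ^ d + 8) * d ^ 2"
      unfolding N_def cs_def length_grid_cones[of d t K G, symmetric] by (rule nn_size_cone_net[OF d])
    also have "\<dots> \<le> (28 * (t + 1) ^ d) * d ^ 2"
      using one_le_power[of "t + 1" d] by (intro mult_right_mono) auto
    finally have "real (nn_size N) \<le> real (28 * ((t + 1) ^ d * d ^ 2))"
      unfolding of_nat_le_iff by (simp add: mult.assoc)
    then have size: "real (nn_size N) \<le> 28 * S" using P by simp

    \<comment> \<open>\<open>H\<close> will bound every numerator and denominator. The critical one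
      is \<open>R\<close>, at most \<open>2 * Y ^ 3 + 1\<close> because
      \<open>\<rho> \<le> Y\<close> and \<open>K \<le> 2 * Y ^ 2\<close>.\<close>
    define H where "H = Y ^ 4"
    have Y_le_H: "Y \<le> H" using Y4 power_increasing[of 1 4 Y] by (simp add: H_def)
    have "0 < 1 / \<epsilon>" using \<epsilon> by simp
    then have inv\<epsilon>: "1 / \<epsilon> + 1 \<le> Y" "real d \<le> Y" "real n \<le> Y" "S \<le> Y"
      using Sd unfolding Y_def by linarith+
    have "2 * real d * (1 / \<epsilon> + 1) \<le> 2 * Y * Y"
      using inv\<epsilon> \<open>0 < 1 / \<epsilon>\<close> Y4 by (intro mult_mono) auto
    then have K_le: "real K \<le> 2 * (Y * Y)" using K(2) by simp
    have xS: "20 * x + 1 \<le> S"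
    proof -
      have "20 * x + 1 \<le> (20 * x + 1) ^ d" using x1 d power_increasing[of 1 d "20 * x + 1"] by simp
      also have "\<dots> \<le> S" unfolding S using x1 d mult_right_mono[of 1 "real d" "(20 * x + 1) ^ d"] by simp
      finally show ?thesis .
    qed
    have "\<rho> * 1 \<le> \<rho> * (real d / \<epsilon>)"
      using \<rho> d \<epsilon> \<epsilon>1 by (intro mult_left_mono) (auto simp: field_simps)
    then have \<rho>x: "\<rho> \<le> x" by (simp add: x_def)
    have "\<rho> \<le> Y" using \<rho>x xS inv\<epsilon>(4) x1 by linarith
    then have "\<rho> * real K \<le> Y * (2 * (Y * Y))"
      using K_le Y4 by (intro mult_mono) auto
    then have R_le: "R \<le> 2 * (Y * (Y * Y)) + 1" using R(2) by linarith
    have Y2: "4 * 4 \<le> Y * Y" using Y4 by (intro mult_mono) auto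
    have Y3: "4 * (Y * Y) \<le> Y * (Y * Y)" using Y4 by (intro mult_right_mono) auto
    have "4 * (Y * (Y * Y)) \<le> Y * (Y * (Y * Y))" using Y4 by (intro mult_right_mono) auto
    then have "4 * (Y * (Y * Y)) \<le> H" by (simp add: H_def eval_nat_numeral mult.assoc)
    then have RH: "R \<le> H" and KH: "real K \<le> H"
      using R_le K_le Y2 Y3 by linarith+
    have "0 \<le> \<rho> * real K" using \<rho> by simp
    then have R0: "0 \<le> R" using R(1) by linarith
    have tH: "real t \<le> H" using t(2) xS inv\<epsilon>(4) Y_le_H x1 by linarith
    have nH: "real n \<le> H" using inv\<epsilon>(3) Y_le_H by linarith
    have H1: "1 \<le> H" using Y4 Y_le_H by linarith

    define F where "F = {of_int a / of_nat b :: rat | a b. \<bar>real_of_int a\<bar> \<le> H \<and> 0 < b \<and> real b \<le> H}"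
    have F: "of_int a / of_nat b \<in> F" if "\<bar>real_of_int a\<bar> \<le> H" "0 < b" "real b \<le> H" for a b
      using that unfolding F_def by blast
    have F_consts: "{0, 1, - 1, of_nat n, - \<rho>'} \<subseteq> F"
      using F[of 0 1] F[of 1 1] F[of "-1" 1] F[of "int n" 1] F[of "- R" K] H1 nH RH R0 KH K0
      by (simp add: \<rho>'_def)
    have F_cones: "insert \<phi> (v ` {..<d} \<union> uminus ` v ` {..<d}) \<subseteq> F" if vp: "(v, \<phi>) \<in> set cs" for v \<phi>
    proof -
      obtain us where us: "us \<in> set (List.n_lists d [0..<t + 1])"
        "v = (\<lambda>j. of_nat (us ! j) / of_nat t)"
        "\<phi> = of_int \<lfloor>real K * G (restrict (\<lambda>j. real (us ! j) / real t) {..<d})\<rfloor> / of_nat K"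
        using vp unfolding cs_def grid_cones_def by auto
      let ?G = "G (restrict (\<lambda>j. real (us ! j) / real t) {..<d})"
      have G: "0 \<le> ?G" "?G \<le> 1"
        using G01[OF restrict_grid_point_in_unit_cube[OF us(1)]] by auto
      have "real K * ?G \<le> real K * 1" using G by (intro mult_left_mono) auto
      then have "\<lfloor>real K * ?G\<rfloor> \<le> int K" "0 \<le> \<lfloor>real K * ?G\<rfloor>" using G by (auto simp: floor_le_iff)
      then have "\<phi> \<in> F" unfolding us(3) using K0 KH by (intro F) auto
      moreover have "v j \<in> F" "- v j \<in> F" if j: "j < d" for j
      proof -
        have "us ! j \<le> t" using us(1) j by (rule n_lists_nth_le)
        then show "v j \<in> F" "- v j \<in> F"
          using F[of "int (us ! j)" t] F[of "- int (us ! j)" t] tH t0 by (simp_all add: us(2))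
      qed
      ultimately show ?thesis by blast
    qed
    have "params L \<subseteq> F" if "L \<in> set N" for L
    proof -
      have "(case p of (v, \<phi>) \<Rightarrow> insert \<phi> (v ` {..<d} \<union> uminus ` v ` {..<d})) \<subseteq> F" if "p \<in> set cs" for p
        using F_cones[of "fst p" "snd p"] that by (simp add: case_prod_beta)
      then show ?thesis
        using params_cone_net[OF that[unfolded N_def]] F_consts by blast
    qed
    then have bits: "real (rat_bits a) \<le> 2 * (log 2 H + 2)" if "L \<in> set N" "a \<in> params L" for L a
      using that unfolding F_def by (intro int_frac_bits_le) blast
    \<comment> \<open>A power of \<open>Y\<close> costs only a constant factor in bits: with
      \<open>ln 2 \<ge> 2 / 3\<close> and \<open>ln Y \<ge> 1\<close> the constant is 2 * 6 + 4 =
      16.\<close>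
    have "log 2 H = 4 * ln Y / ln 2" using Y4 by (simp add: H_def log_def ln_realpow)
    also have "\<dots> \<le> 4 * ln Y / (2 / 3)"
      using lnY ln2_ge_two_thirds by (intro divide_left_mono) auto
    finally have logH: "2 * (log 2 H + 2) \<le> 16 * ln Y" using lnY by simp
    have "real (nn_space N) \<le> 2 * (log 2 H + 2) * real (nn_size N)"
      by (rule nn_space_le[OF wf bits])
    also have "\<dots> \<le> (16 * ln Y) * (28 * S)"
      by (rule mult_mono[OF logH size]) (use lnY in simp_all)
    also have "\<dots> = 448 * (S * ln Y)" by simp
    also have "\<dots> \<le> 1000 * S * ln Y" using SlnY Sd by linarith
    finally have "real (nn_space N) \<le> 1000 * S * ln Y" .
    moreover have "real (nn_time N) \<le> 1000 * S * ln Y"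
      using size SlnY Sd unfolding nn_time_eq by simp
    ultimately show ?thesis using wf meas approx net by blast
  qed
qed

section \<open>Concentration in L1\<close>

text \<open>Independence splits the moment into \<open>n\<close> factors, each bounded by
  Hoeffding's lemma at \<open>l / n\<close>; the \<open>n\<close> exponents add up to
  \<open>l^2 / (8 * n)\<close>. The left end \<open>a\<close> is free so that the bound also covers
  \<open>- f\<close>, with \<open>a = - 1\<close>.\<close>

lemma nn_integral_mean_exp_le:
  fixes f :: "'a \<Rightarrow> real"
  assumes M: "prob_space M" and f: "f \<in> borel_measurable M"
    and int: "AE x in M. f x \<in> {a..a + 1}" and l: "0 < l" and n: "1 \<le> n"
  shows "(\<integral>\<^sup>+D. exp (l * ((\<Sum>k<n. f (D k) - integral\<^sup>L M f) / real n)) \<partial>PiM {..<n} (\<lambda>_. M))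
    \<le> ennreal (exp (l\<^sup>2 / (8 * real n)))"
proof -
  interpret interval_bounded_random_variable M f a "a + 1"
    by (intro interval_bounded_random_variable.intro interval_bounded_random_variable_axioms.intro assms)
  interpret product_prob_space "\<lambda>_::nat. M" by (rule product_prob_spaceI) fact
  have "(\<integral>\<^sup>+D. exp (l * ((\<Sum>k<n. f (D k) - integral\<^sup>L M f) / real n)) \<partial>PiM {..<n} (\<lambda>_. M))
      = (\<integral>\<^sup>+D. (\<Prod>k<n. ennreal (exp (l / real n * (f (D k) - integral\<^sup>L M f)))) \<partial>PiM {..<n} (\<lambda>_. M))"
    by (simp add: prod_ennreal exp_sum[symmetric] sum_distrib_left[symmetric]
        sum_divide_distrib[symmetric])
  also have "\<dots> = (\<Prod>k<n. \<integral>\<^sup>+x. ennreal (exp (l / real n * (f x - integral\<^sup>L M f))) \<partial>M)"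
    by (rule product_nn_integral_prod) (use f in measurable)
  also have "\<dots> \<le> (\<Prod>k<n. ennreal (exp ((l / real n)\<^sup>2 * (a + 1 - a)\<^sup>2 / 8)))"
    using l n by (intro prod_mono_ennreal Hoeffdings_lemma_nn_integral) auto
  also have "\<dots> = ennreal (exp (\<Sum>k<n. (l / real n)\<^sup>2 / 8))"
    by (simp add: prod_ennreal exp_sum del: prod_constant sum_constant)
  also have "(\<Sum>k<n. (l / real n)\<^sup>2 / 8) = l\<^sup>2 / (8 * real n)"
    using n by (simp add: field_simps power2_eq_square)
  finally show ?thesis .
qed

text \<open>The factor 2 comes from bounding \<open>exp (l * \<bar>z\<bar>)\<close> by
  \<open>exp (l * z) + exp (- l * z)\<close>.\<close>

lemma nn_integral_mean_exp_abs_le: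
  fixes f :: "'a \<Rightarrow> real"
  assumes M: "prob_space M" and f[measurable]: "f \<in> borel_measurable M"
    and int: "AE x in M. f x \<in> {0..1}" and l: "0 < l" and n: "1 \<le> n"
  shows "(\<integral>\<^sup>+D. exp (l * \<bar>(\<Sum>k<n. f (D k) - integral\<^sup>L M f) / real n\<bar>) \<partial>PiM {..<n} (\<lambda>_. M))
    \<le> ennreal (2 * exp (l\<^sup>2 / (8 * real n)))"
proof -
  let ?X = "\<lambda>D. (\<Sum>k<n. f (D k) - integral\<^sup>L M f) / real n"
  let ?X' = "\<lambda>D. (\<Sum>k<n. - f (D k) - (\<integral>x. - f x \<partial>M)) / real n"
  have X': "?X' D = - ?X D" for D
    by (simp add: sum_subtractf sum_negf minus_divide_left)
  have "(\<integral>\<^sup>+D. exp (l * \<bar>?X D\<bar>) \<partial>PiM {..<n} (\<lambda>_. M))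
      \<le> (\<integral>\<^sup>+D. ennreal (exp (l * ?X D)) + ennreal (exp (l * ?X' D)) \<partial>PiM {..<n} (\<lambda>_. M))"
    unfolding X' by (intro nn_integral_mono) (auto simp: abs_if simp flip: ennreal_plus)
  also have "\<dots> = (\<integral>\<^sup>+D. exp (l * ?X D) \<partial>PiM {..<n} (\<lambda>_. M)) + (\<integral>\<^sup>+D. exp (l * ?X' D) \<partial>PiM {..<n} (\<lambda>_. M))"
    by (rule nn_integral_add) measurable
  also have "\<dots> \<le> ennreal (exp (l\<^sup>2 / (8 * real n))) + ennreal (exp (l\<^sup>2 / (8 * real n)))"
    by (intro add_mono nn_integral_mean_exp_le[where a=0] nn_integral_mean_exp_le[where a="-1"] assms)
      (use int in auto)
  finally show ?thesis by (simp flip: ennreal_plus)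
qed

lemma (in prob_space) expectation_mem_unit_interval:
  assumes "f \<in> borel_measurable M" "AE x in M. f x \<in> {0..1::real}"
  shows "expectation f \<in> {0..1}"
proof -
  have "integrable M f" using assms by (intro integrable_const_bound[where B=1]) auto
  then have "expectation f \<le> expectation (\<lambda>_. 1)" using assms by (intro integral_mono_AE) auto
  moreover have "0 \<le> expectation f" using assms by (intro integral_nonneg_AE) auto
  ultimately show ?thesis by (simp add: prob_space)
qed

section \<open>Tail of the L1 deviation for an abstract family of observables
  \<open>f x y\<close>\<close>

context
  fixes M :: "'a measure" and N :: "'b measure" and f :: "'a \<Rightarrow> 'b \<Rightarrow> real" and n :: nat
  assumes M: "prob_space M" and N: "prob_space N"
    and f [measurable]: "(\<lambda>(x, y). f x y) \<in> borel_measurable (M \<Otimes>\<^sub>M N)"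
    and f01: "AE x in M. \<forall>y\<in>space N. f x y \<in> {0..1}" and n: "1 \<le> n"
begin

abbreviation deviation :: "(nat \<Rightarrow> 'a) \<Rightarrow> 'b \<Rightarrow> real" where
  "deviation D y \<equiv> (\<Sum>k<n. f (D k) y - (\<integral>x. f x y \<partial>M)) / real n"

lemma measurable_deviation [measurable]:
  "(\<lambda>(D, y). deviation D y) \<in> borel_measurable (PiM {..<n} (\<lambda>_. M) \<Otimes>\<^sub>M N)"
proof -
  interpret M: prob_space M by fact
  show ?thesis by measurable
qed

text \<open>The null set in \<open>f01\<close> does not depend on \<open>y\<close>. A finite union
  over \<open>k < n\<close> thus leaves a null set outside which every term, at every
  \<open>y\<close>, is a difference of two numbers in [0,1].\<close>

lemma AE_deviation_le_1:
  "AE D in PiM {..<n} (\<lambda>_. M). (\<integral>\<^sup>+y. \<bar>deviation D y\<bar> \<partial>N) \<le> 1"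
proof -
  interpret M: prob_space M by fact
  interpret N: prob_space N by fact
  have "AE D in PiM {..<n} (\<lambda>_. M). \<forall>k\<in>{..<n}. \<forall>y\<in>space N. f (D k) y \<in> {0..1}"
  proof (rule AE_finite_allI)
    fix k assume "k \<in> {..<n}"
    then show "AE D in PiM {..<n} (\<lambda>_. M). \<forall>y\<in>space N. f (D k) y \<in> {0..1}"
      using AE_PiM_component[of "{..<n}" "\<lambda>_. M" k, OF M _ f01] by blast
  qed simp
  then show ?thesis
  proof eventually_elim
    case (elim D)
    have "\<bar>deviation D y\<bar> \<le> 1" if y: "y \<in> space N" for y
    proof -
      have E: "(\<integral>x. f x y \<partial>M) \<in> {0..1}"
        using f01 y by (intro M.expectation_mem_unit_interval) auto
      have "\<bar>\<Sum>k<n. f (D k) y - (\<integral>x. f x y \<partial>M)\<bar> \<le> (\<Sum>k<n. 1)"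
      proof (intro order_trans[OF sum_abs] sum_mono)
        fix k assume "k \<in> {..<n}"
        then have "f (D k) y \<in> {0..1}" using elim y by blast
        with E show "\<bar>f (D k) y - (\<integral>x. f x y \<partial>M)\<bar> \<le> 1" by auto
      qed
      then show ?thesis using n by (simp add: field_simps)
    qed
    then have "(\<integral>\<^sup>+y. \<bar>deviation D y\<bar> \<partial>N) \<le> (\<integral>\<^sup>+y. 1 \<partial>N)"
      by (intro nn_integral_mono) auto
    then show ?case by (simp add: N.emeasure_space_1)
  qed
qed

lemma sets_large_deviation:
  "{D \<in> space (PiM {..<n} (\<lambda>_. M)). c \<le> (\<integral>\<^sup>+y. \<bar>deviation D y\<bar> \<partial>N)} \<in> sets (PiM {..<n} (\<lambda>_. M))"
proof -
  interpret N: prob_space N by fact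
  show ?thesis by measurable
qed

text \<open>Integrating the tangent inequality exp a * (1 + z - a) \<le> exp z in y replaces Jensen's
  inequality: where the mean deviation is at least \<epsilon>, the mean of exp (l * deviation) is at
  least exp (l * \<epsilon>), and Markov's inequality applies.\<close>

lemma L1_deviation_tail:
  assumes \<epsilon>: "0 < \<epsilon>"
  shows "measure (PiM {..<n} (\<lambda>_. M))
      {D \<in> space (PiM {..<n} (\<lambda>_. M)). ennreal \<epsilon> \<le> (\<integral>\<^sup>+y. \<bar>deviation D y\<bar> \<partial>N)}
    \<le> 2 * exp (- 2 * real n * \<epsilon>\<^sup>2)"
proof -
  interpret M: prob_space M by fact
  interpret N: prob_space N by fact
  let ?P = "PiM {..<n} (\<lambda>_. M)"
  interpret P: prob_space ?P by (intro prob_space_PiM M)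
  interpret PN: pair_sigma_finite ?P N ..
  \<comment> \<open>This value minimises the exponent \<open>l^2 / (8 * n) - l * \<epsilon>\<close>
    and yields \<open>- 2 * n * \<epsilon>^2\<close>.\<close>
  define l where "l = 4 * real n * \<epsilon>"
  have l: "0 < l" using n \<epsilon> by (simp add: l_def)
  define a where "a = l * \<epsilon>"
  have a: "0 < a" using l \<epsilon> by (simp add: a_def)
  let ?E = "{D \<in> space ?P. ennreal \<epsilon> \<le> (\<integral>\<^sup>+y. \<bar>deviation D y\<bar> \<partial>N)}"
  note sets_large_deviation[measurable]
  have mean_exp: "ennreal (exp a) \<le> (\<integral>\<^sup>+y. exp (l * \<bar>deviation D y\<bar>) \<partial>N)" if D: "D \<in> ?E" for D
  proof -
    define u where "u y = ennreal \<bar>deviation D y\<bar>" for y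
    define e where "e y = ennreal (exp (l * \<bar>deviation D y\<bar>))" for y
    have dev [measurable]: "(\<lambda>y. deviation D y) \<in> borel_measurable N"
      using D measurable_Pair2[OF measurable_deviation, of D] by simp
    have [measurable]: "u \<in> borel_measurable N" "e \<in> borel_measurable N"
      unfolding u_def e_def by measurable
    \<comment> \<open>The tangent of \<open>exp\<close> at \<open>a\<close>, arranged without
      subtraction so that it can be integrated in \<open>ennreal\<close>.\<close>
    have tangent: "exp a + exp a * z \<le> exp z + exp a * a" for z :: real
    proof -
      have "exp a * (1 + (z - a)) \<le> exp a * exp (z - a)" by (intro mult_left_mono) auto
      then show ?thesis by (simp add: exp_diff algebra_simps)
    qed
    have "ennreal (exp a) * ennreal a + ennreal (exp a)
        = ennreal (exp a) + ennreal (exp a * l) * ennreal \<epsilon>"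
      using a l \<epsilon> by (simp add: a_def add.commute mult.assoc flip: ennreal_mult)
    also have "\<dots> \<le> ennreal (exp a) + ennreal (exp a * l) * (\<integral>\<^sup>+y. u y \<partial>N)"
      unfolding u_def using D by (intro add_left_mono mult_left_mono) auto
    also have "\<dots> = (\<integral>\<^sup>+y. ennreal (exp a) + ennreal (exp a * l) * u y \<partial>N)"
      by (simp add: nn_integral_add nn_integral_cmult N.emeasure_space_1)
    also have "\<dots> \<le> (\<integral>\<^sup>+y. e y + ennreal (exp a * a) \<partial>N)"
      using l a tangent[of "l * \<bar>deviation D y\<bar>" for y]
      unfolding u_def e_def by (intro nn_integral_mono) (simp add: mult.assoc flip: ennreal_mult ennreal_plus)
    also have "\<dots> = ennreal (exp a) * ennreal a + (\<integral>\<^sup>+y. e y \<partial>N)"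
      using a by (simp add: nn_integral_add N.emeasure_space_1 ennreal_mult add.commute)
    \<comment> \<open>The common summand \<open>exp a * a\<close> is finite and cancels.\<close>
    finally show ?thesis
      unfolding e_def by (simp add: ennreal_mult_eq_top_iff)
  qed
  have "ennreal (exp a) * emeasure ?P ?E = (\<integral>\<^sup>+D. ennreal (exp a) * indicator ?E D \<partial>?P)"
    by (simp add: nn_integral_cmult_indicator)
  also have "\<dots> \<le> (\<integral>\<^sup>+D. \<integral>\<^sup>+y. exp (l * \<bar>deviation D y\<bar>) \<partial>N \<partial>?P)"
    using mean_exp by (intro nn_integral_mono) (auto split: split_indicator)
  \<comment> \<open>Exchanging the integrals leaves, for each fixed \<open>y\<close>, the
    exponential moment of a mean of independent terms.\<close>
  also have "\<dots> = (\<integral>\<^sup>+y. \<integral>\<^sup>+D. exp (l * \<bar>deviation D y\<bar>) \<partial>?P \<partial>N)"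
    by (rule PN.Fubini'[symmetric]) measurable
  also have "\<dots> \<le> (\<integral>\<^sup>+y. ennreal (2 * exp (l\<^sup>2 / (8 * real n))) \<partial>N)"
    using f01 by (intro nn_integral_mono nn_integral_mean_exp_abs_le M l n) auto
  also have "\<dots> = ennreal (2 * exp (l\<^sup>2 / (8 * real n)))" by (simp add: N.emeasure_space_1)
  finally have "exp a * measure ?P ?E \<le> 2 * exp (l\<^sup>2 / (8 * real n))"
    by (simp add: P.emeasure_eq_measure flip: ennreal_mult)
  then have "measure ?P ?E \<le> 2 * exp (l\<^sup>2 / (8 * real n) - a)"
    by (simp add: exp_diff field_simps)
  also have "l\<^sup>2 / (8 * real n) - a = - 2 * real n * \<epsilon>\<^sup>2"
    using n by (simp add: l_def a_def field_simps power2_eq_square)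
  finally show ?thesis .
qed

text \<open>For \<open>\<epsilon> \<le> 1\<close> the factor before the exponential is at least 2,
  so the sharper tail suffices; for larger \<open>\<epsilon>\<close> the event is null by
  \<open>AE_deviation_le_1\<close>.\<close>

lemma L1_deviation_tail_dim:
  fixes d :: nat
  assumes \<epsilon>: "0 < \<epsilon>" and d: "1 \<le> d"
  shows "measure (PiM {..<n} (\<lambda>_. M))
      {D \<in> space (PiM {..<n} (\<lambda>_. M)). ennreal \<epsilon> \<le> (\<integral>\<^sup>+y. \<bar>deviation D y\<bar> \<partial>N)}
    \<le> 2 ^ (d + 1) * real d * \<epsilon> powr (- real d) * exp (- (\<epsilon>\<^sup>2 * real n) / 2)"
proof (cases "\<epsilon> \<le> 1")
  case True
  have "2 * exp (- 2 * real n * \<epsilon>\<^sup>2) \<le> 2 * exp (- (\<epsilon>\<^sup>2 * real n) / 2)" by simp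
  also have "1 * 1 * 1 \<le> 2 ^ d * real d * \<epsilon> powr (- real d)"
    using True d \<epsilon> powr_mono2'[of "- real d" \<epsilon> 1] by (intro mult_mono) auto
  then have "2 * exp (- (\<epsilon>\<^sup>2 * real n) / 2)
      \<le> (2 ^ d * real d * \<epsilon> powr (- real d)) * (2 * exp (- (\<epsilon>\<^sup>2 * real n) / 2))"
    using mult_right_mono[of 1 "2 ^ d * real d * \<epsilon> powr (- real d)" "2 * exp (- (\<epsilon>\<^sup>2 * real n) / 2)"] by simp
  finally show ?thesis using L1_deviation_tail[OF \<epsilon>] by (simp add: mult_ac)
next
  case False
  interpret P: prob_space "PiM {..<n} (\<lambda>_. M)" by (intro prob_space_PiM M)
  have "1 < ennreal \<epsilon>" using False by simp
  then have "\<not> ennreal \<epsilon> \<le> w" if "w \<le> 1" for w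
    using order.strict_trans1[OF that] by (simp add: not_le)
  then have "AE D in PiM {..<n} (\<lambda>_. M). \<not> ennreal \<epsilon> \<le> (\<integral>\<^sup>+y. \<bar>deviation D y\<bar> \<partial>N)"
    by (intro eventually_mono[OF AE_deviation_le_1])
  then have "measure (PiM {..<n} (\<lambda>_. M))
      {D \<in> space (PiM {..<n} (\<lambda>_. M)). ennreal \<epsilon> \<le> (\<integral>\<^sup>+y. \<bar>deviation D y\<bar> \<partial>N)} = 0"
    by (intro P.prob_eq_0_AE)
  then show ?thesis by simp
qed

end

section \<open>Query functions\<close>

definition point_query :: "agg \<Rightarrow> nat \<Rightarrow> nat \<Rightarrow> (nat \<Rightarrow> real) \<Rightarrow> (nat \<Rightarrow> real) \<Rightarrow> real" where
  "point_query i dbar m p q =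
     (if matches dbar p q then (case i of CountQ \<Rightarrow> 1 | SumQ \<Rightarrow> p m) else 0)"

lemma query_fun_eq_sum: "query_fun i dbar m n D q = (\<Sum>k<n. point_query i dbar m (D k) q)"
proof (cases i)
  case SumQ
  have "(\<Sum>k\<in>{k \<in> {..<n}. matches dbar (D k) q}. D k m)
      = (\<Sum>k<n. if matches dbar (D k) q then D k m else 0)"
    by (rule sum.inter_filter) simp
  then show ?thesis using SumQ by (simp add: query_fun_def point_query_def cong: if_cong)
next
  case CountQ
  have "real (card {k \<in> {..<n}. matches dbar (D k) q})
      = (\<Sum>k\<in>{k \<in> {..<n}. matches dbar (D k) q}. 1)"
    by simp
  also have "\<dots> = (\<Sum>k<n. if matches dbar (D k) q then 1 else 0)"
    by (rule sum.inter_filter) simp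
  finally show ?thesis using CountQ by (simp add: query_fun_def point_query_def cong: if_cong)
qed

text \<open>Point and query both depend on a parameter, so that measurability in the point alone, in
  the query alone and in the pair are all instances.\<close>

lemma measurable_point_query:
  assumes "\<And>j. j < dbar \<Longrightarrow> (\<lambda>x. f x j) \<in> borel_measurable M"
      "\<And>j. j < 2 * dbar \<Longrightarrow> (\<lambda>x. g x j) \<in> borel_measurable M"
    and "m < dbar"
  shows "(\<lambda>x. point_query i dbar m (f x) (g x)) \<in> borel_measurable M"
proof -
  have [measurable]: "Measurable.pred M (\<lambda>x. matches dbar (f x) (g x))"
    unfolding matches_def
  proof (rule pred_intros_countable(1))
    fix j :: nat
    show "Measurable.pred M (\<lambda>x. j < dbar \<longrightarrow> g x j \<le> f x j \<and> f x j < g x j + g x (dbar + j))"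
    proof (cases "j < dbar")
      case True
      then have [measurable]: "(\<lambda>x. f x j) \<in> borel_measurable M" "(\<lambda>x. g x j) \<in> borel_measurable M"
        "(\<lambda>x. g x (dbar + j)) \<in> borel_measurable M"
        by (auto intro: assms)
      show ?thesis by measurable
    qed simp
  qed
  have [measurable]: "(\<lambda>x. f x m) \<in> borel_measurable M" by (intro assms)
  show ?thesis unfolding point_query_def by (cases i) (simp_all cong: if_cong)
qed

lemma point_query_mem_unit_interval:
  assumes "p \<in> unit_cube dbar" "m < dbar"
  shows "point_query i dbar m p q \<in> {0..1}"
  using assms by (auto simp: point_query_def unit_cube_def PiE_iff split: agg.split)

text \<open>The infimum is attained: a difference quotient lies below every admissible constant,
  hence below their infimum. The set of constants is nonempty because a negative
  \<open>\<rho>\<close> can be replaced by 0.\<close>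

lemma l1_lipschitz_const_props:
  assumes "\<exists>\<rho>. l1_lipschitz_on d \<rho> S g"
  shows "0 \<le> l1_lipschitz_const d S g" "l1_lipschitz_on d (l1_lipschitz_const d S g) S g"
proof -
  let ?R = "{\<rho>. 0 \<le> \<rho> \<and> l1_lipschitz_on d \<rho> S g}"
  obtain \<rho> where \<rho>: "l1_lipschitz_on d \<rho> S g" using assms by blast
  have "\<bar>g x - g y\<bar> \<le> max 0 \<rho> * l1_dist d x y" if "x \<in> S" "y \<in> S" for x y
    using \<rho> that mult_right_mono[of \<rho> "max 0 \<rho>" "l1_dist d x y"] l1_dist_nonneg[of d x y]
    unfolding l1_lipschitz_on_def by (meson max.cobounded2 order_trans)
  then have R: "max 0 \<rho> \<in> ?R" by (simp add: l1_lipschitz_on_def)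
  then show "0 \<le> l1_lipschitz_const d S g"
    unfolding l1_lipschitz_const_def by (intro cInf_greatest[of ?R 0]) (blast, simp)
  show "l1_lipschitz_on d (l1_lipschitz_const d S g) S g"
    unfolding l1_lipschitz_on_def
  proof (intro ballI)
    fix x y assume xy: "x \<in> S" "y \<in> S"
    show "\<bar>g x - g y\<bar> \<le> l1_lipschitz_const d S g * l1_dist d x y"
    proof (cases "l1_dist d x y = 0")
      \<comment> \<open>At distance 0 there is no quotient to compare, but any Lipschitz bound
        already forces equal values.\<close>
      case True
      have "\<bar>g x - g y\<bar> \<le> \<rho> * l1_dist d x y" using \<rho> xy unfolding l1_lipschitz_on_def by blast
      then show ?thesis unfolding True by simp
    next
      case False
      then have pos: "0 < l1_dist d x y" using l1_dist_nonneg[of d x y] by linarith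
      have "\<bar>g x - g y\<bar> / l1_dist d x y \<le> l1_lipschitz_const d S g"
        unfolding l1_lipschitz_const_def
      proof (rule cInf_greatest)
        fix r assume "r \<in> ?R"
        then have "\<bar>g x - g y\<bar> \<le> r * l1_dist d x y" using xy by (simp add: l1_lipschitz_on_def)
        then show "\<bar>g x - g y\<bar> / l1_dist d x y \<le> r" using pos by (simp add: pos_divide_le_eq)
      qed (use R in blast)
      then show ?thesis using pos by (simp add: pos_divide_le_eq)
    qed
  qed
qed

section \<open>Lebesgue measure on the unit cube and the query space\<close>

lemma sigma_finite_lebesgue_k: "sigma_finite_measure (lebesgue_k k)"
proof -
  interpret product_sigma_finite "\<lambda>_::nat. lborel :: real measure" by standard
  show ?thesis unfolding lebesgue_k_def by (rule sigma_finite) simp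
qed

lemma measurable_lebesgue_k_component: "j < k \<Longrightarrow> (\<lambda>q. q j) \<in> borel_measurable (lebesgue_k k)"
  by (auto simp: lebesgue_k_def intro!: measurable_component_singleton)

lemma emeasure_unit_cube: "emeasure (lebesgue_k k) (unit_cube k) = 1"
proof -
  interpret product_sigma_finite "\<lambda>_::nat. lborel :: real measure" by standard
  show ?thesis unfolding lebesgue_k_def unit_cube_def by (subst emeasure_PiM) auto
qed

text \<open>\<open>emeasure\<close> is 0 on nonmeasurable sets, so measure 1 forces
  measurability.\<close>

lemma unit_cube_in_sets: "unit_cube k \<in> sets (lebesgue_k k)"
  using emeasure_neq_0_sets[of "lebesgue_k k" "unit_cube k"] by (simp add: emeasure_unit_cube)

lemma query_space_in_sets: "query_space dbar \<in> sets (lebesgue_k (2 * dbar))"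
proof -
  let ?L = "lebesgue_k (2 * dbar)"
  have "{q \<in> space ?L. \<forall>j\<in>{..<dbar}. q j + q (dbar + j) \<le> 1} \<in> sets ?L"
  proof (rule sets.sets_Collect_finite_All)
    fix j assume j: "j \<in> {..<dbar}"
    have [measurable]: "(\<lambda>q. q j) \<in> borel_measurable ?L" "(\<lambda>q. q (dbar + j)) \<in> borel_measurable ?L"
      using j by (auto intro!: measurable_lebesgue_k_component)
    show "{q \<in> space ?L. q j + q (dbar + j) \<le> 1} \<in> sets ?L" by measurable
  qed simp
  moreover have "query_space dbar = unit_cube (2 * dbar) \<inter> {q \<in> space ?L. \<forall>j\<in>{..<dbar}. q j + q (dbar + j) \<le> 1}"
    using sets.sets_into_space[OF unit_cube_in_sets] by (auto simp: query_space_def)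
  ultimately show ?thesis using unit_cube_in_sets by simp
qed

section \<open>Queries under a fixed data distribution\<close>

context
  fixes dbar m n :: nat and Chi :: "(nat \<Rightarrow> real) measure" and i :: agg
  assumes Chi: "prob_space Chi" and sets_Chi: "sets Chi = sets (PiM {..<dbar} (\<lambda>_. borel :: real measure))"
    and Chi_cube: "emeasure Chi (unit_cube dbar) = 1" and n: "1 \<le> n" and m: "m < dbar"
begin

lemma measurable_Chi_component: "j < dbar \<Longrightarrow> (\<lambda>p. p j) \<in> borel_measurable Chi"
  unfolding measurable_cong_sets[OF sets_Chi refl] by (rule measurable_component_singleton) simp

lemma AE_Chi_unit_cube: "AE p in Chi. p \<in> unit_cube dbar"
proof -
  interpret prob_space Chi by (fact Chi)
  have "unit_cube dbar \<in> sets Chi"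
    using emeasure_neq_0_sets[of Chi "unit_cube dbar"] by (simp add: Chi_cube)
  then show ?thesis using Chi_cube by (subst AE_in_set_eq_1) (auto simp: measure_def)
qed

abbreviation mean_query :: "(nat \<Rightarrow> real) \<Rightarrow> real" where
  "mean_query q \<equiv> \<integral>p. point_query i dbar m p q \<partial>Chi"

lemma measurable_point_query_Chi: "(\<lambda>p. point_query i dbar m p q) \<in> borel_measurable Chi"
  by (intro measurable_point_query measurable_Chi_component m) auto

lemma mean_query_mem_unit_interval: "mean_query q \<in> {0..1}"
proof -
  interpret prob_space Chi by (fact Chi)
  show ?thesis
    using AE_Chi_unit_cube
    by (intro expectation_mem_unit_interval measurable_point_query_Chi)
      (auto elim!: eventually_mono dest: point_query_mem_unit_interval[OF _ m])
qed

text \<open>Every component of the database has law \<open>Chi\<close>, so the expectation is a sum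
  of \<open>n\<close> equal terms, which \<open>1 / n\<close> cancels; the result is free of
  \<open>n\<close>.\<close>

lemma dist_query_fun_eq_mean_query: "dist_query_fun i dbar m Chi n q = mean_query q"
proof -
  interpret Chi: prob_space Chi by (fact Chi)
  interpret DB: prob_space "PiM {..<n} (\<lambda>_. Chi)" by (intro prob_space_PiM Chi)
  note [measurable] = measurable_point_query_Chi
  have int: "integrable (PiM {..<n} (\<lambda>_. Chi)) (\<lambda>D. point_query i dbar m (D k) q)" if "k \<in> {..<n}" for k
  proof (rule DB.integrable_const_bound[where B=1])
    have "AE D in PiM {..<n} (\<lambda>_. Chi). D k \<in> unit_cube dbar"
      using AE_PiM_component[OF _ that AE_Chi_unit_cube] Chi by simp
    then show "AE D in PiM {..<n} (\<lambda>_. Chi). norm (point_query i dbar m (D k) q) \<le> 1"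
    proof eventually_elim
      case (elim D)
      then show ?case using point_query_mem_unit_interval[OF elim m, of i q] by simp
    qed
    show "(\<lambda>D. point_query i dbar m (D k) q) \<in> borel_measurable (PiM {..<n} (\<lambda>_. Chi))"
      using that by measurable
  qed
  have "(\<integral>D. point_query i dbar m (D k) q \<partial>PiM {..<n} (\<lambda>_. Chi)) = mean_query q" if "k \<in> {..<n}" for k
  proof -
    have "mean_query q = (\<integral>p. point_query i dbar m p q \<partial>distr (PiM {..<n} (\<lambda>_. Chi)) Chi (\<lambda>D. D k))"
      using distr_PiM_component[of "{..<n}" "\<lambda>_. Chi" k] that Chi by simp
    also have "\<dots> = (\<integral>D. point_query i dbar m (D k) q \<partial>PiM {..<n} (\<lambda>_. Chi))"
      by (rule integral_distr) (use that in measurable)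
    finally show ?thesis by simp
  qed
  then show ?thesis
    using n int by (simp add: dist_query_fun_def db_measure_def query_fun_eq_sum)
qed

text \<open>An empty range matches nothing: \<open>0 \<le> p m < 0\<close> is impossible. This
  anchors the error bound of the zero network.\<close>

lemma mean_query_zero: "mean_query (restrict (\<lambda>_. 0) {..<2 * dbar}) = 0"
proof -
  have "point_query i dbar m p (restrict (\<lambda>_. 0) {..<2 * dbar}) = 0" for p
    using m by (auto simp: point_query_def matches_def intro!: exI[of _ m])
  then show ?thesis by simp
qed

text \<open>Uniform on the cube rather than on the query space: the cube has volume 1, so no
  normalising factor appears, and \<open>restricted_query\<close> confines the integrands to the
  query space.\<close>

definition query_measure :: "(nat \<Rightarrow> real) measure" where
  "query_measure = uniform_measure (lebesgue_k (2 * dbar)) (unit_cube (2 * dbar))"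

lemma nn_integral_query_measure:
  assumes "f \<in> borel_measurable (lebesgue_k (2 * dbar))"
  shows "(\<integral>\<^sup>+q. f q \<partial>query_measure) = (\<integral>\<^sup>+q. f q * indicator (unit_cube (2 * dbar)) q \<partial>lebesgue_k (2 * dbar))"
  unfolding query_measure_def nn_integral_uniform_measure[OF assms unit_cube_in_sets] emeasure_unit_cube
  by (simp add: divide_ennreal_def)

definition restricted_query :: "(nat \<Rightarrow> real) \<Rightarrow> (nat \<Rightarrow> real) \<Rightarrow> real" where
  "restricted_query p q = indicator (query_space dbar) q * point_query i dbar m p q"

lemma measurable_restricted_query:
  assumes "\<And>j. j < dbar \<Longrightarrow> (\<lambda>x. f x j) \<in> borel_measurable M"
    and g: "g \<in> measurable M (lebesgue_k (2 * dbar))"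
  shows "(\<lambda>x. restricted_query (f x) (g x)) \<in> borel_measurable M"
proof -
  have "(\<lambda>x. point_query i dbar m (f x) (g x)) \<in> borel_measurable M"
    using measurable_compose[OF g measurable_lebesgue_k_component] assms
    by (intro measurable_point_query m) auto
  moreover note g[measurable] query_space_in_sets[measurable]
  ultimately show ?thesis unfolding restricted_query_def by measurable
qed

abbreviation query_deviation :: "(nat \<Rightarrow> nat \<Rightarrow> real) \<Rightarrow> (nat \<Rightarrow> real) \<Rightarrow> real" where
  "query_deviation D q \<equiv>
     (\<Sum>k<n. restricted_query (D k) q - (\<integral>p. restricted_query p q \<partial>Chi)) / real n"

lemma query_deviation_tail:
  assumes \<epsilon>: "0 < \<epsilon>"
  defines "E \<equiv> {D \<in> space (db_measure Chi n). ennreal \<epsilon> \<le> (\<integral>\<^sup>+q. \<bar>query_deviation D q\<bar> \<partial>query_measure)}"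
  shows "E \<in> sets (db_measure Chi n)"
    and "measure (db_measure Chi n) E
      \<le> 2 ^ (2 * dbar + 1) * real (2 * dbar) * \<epsilon> powr (- real (2 * dbar)) * exp (- (\<epsilon>\<^sup>2 * real n) / 2)"
proof -
  have prob: "prob_space query_measure"
    unfolding query_measure_def by (rule prob_space_uniform_measure) (simp_all add: emeasure_unit_cube)
  have sets: "sets (Chi \<Otimes>\<^sub>M query_measure) = sets (Chi \<Otimes>\<^sub>M lebesgue_k (2 * dbar))"
    by (rule sets_pair_measure_cong) (simp_all add: query_measure_def)
  have meas: "(\<lambda>(p, q). restricted_query p q) \<in> borel_measurable (Chi \<Otimes>\<^sub>M query_measure)"
    unfolding measurable_cong_sets[OF sets refl] case_prod_beta
    by (intro measurable_restricted_query measurable_compose[OF measurable_fst measurable_Chi_component]) auto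
  have AE: "AE p in Chi. \<forall>q\<in>space query_measure. restricted_query p q \<in> {0..1}"
    using AE_Chi_unit_cube
    by eventually_elim (use point_query_mem_unit_interval[OF _ m] in \<open>force simp: restricted_query_def indicator_def\<close>)
  show "E \<in> sets (db_measure Chi n)"
    unfolding E_def db_measure_def by (rule sets_large_deviation[OF Chi prob meas AE n])
  show "measure (db_measure Chi n) E
      \<le> 2 ^ (2 * dbar + 1) * real (2 * dbar) * \<epsilon> powr (- real (2 * dbar)) * exp (- (\<epsilon>\<^sup>2 * real n) / 2)"
    unfolding E_def db_measure_def
    by (rule L1_deviation_tail_dim[OF Chi prob meas AE n \<epsilon>]) (use m in simp)
qed

lemma measurable_query_deviation:
  assumes "D \<in> space (db_measure Chi n)"
  shows "(\<lambda>q. query_deviation D q) \<in> borel_measurable (lebesgue_k (2 * dbar))"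
proof -
  interpret Chi: prob_space Chi by (fact Chi)
  have "(\<lambda>(q, p). restricted_query p q) \<in> borel_measurable (lebesgue_k (2 * dbar) \<Otimes>\<^sub>M Chi)"
    unfolding case_prod_beta
    by (intro measurable_restricted_query measurable_compose[OF measurable_snd measurable_Chi_component]) auto
  then have "(\<lambda>q. \<integral>p. restricted_query p q \<partial>Chi) \<in> borel_measurable (lebesgue_k (2 * dbar))"
    by (rule Chi.borel_measurable_lebesgue_integral)
  moreover have "(\<lambda>q. restricted_query (D k) q) \<in> borel_measurable (lebesgue_k (2 * dbar))" for k
    by (intro measurable_restricted_query) auto
  ultimately show ?thesis by measurable
qed

text \<open>On the query space, \<open>h\<close> minus the query function splits into the
  approximation error, at most \<open>n * \<epsilon>\<close>, and \<open>n\<close> times the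
  deviation. Since the cube has volume 1, integrating the constant \<open>\<epsilon>\<close> gives
  back \<open>\<epsilon>\<close>.\<close>

lemma L1_Q_le_deviation:
  assumes D: "D \<in> space (db_measure Chi n)" and \<epsilon>: "0 \<le> \<epsilon>"
    and h: "\<And>q. q \<in> query_space dbar \<Longrightarrow> \<bar>h q - real n * mean_query q\<bar> \<le> real n * \<epsilon>"
  shows "ennreal (1 / real n) * L1_Q dbar h (query_fun i dbar m n D)
    \<le> ennreal \<epsilon> + (\<integral>\<^sup>+q. \<bar>query_deviation D q\<bar> \<partial>query_measure)"
proof -
  let ?L = "lebesgue_k (2 * dbar)"
  let ?I = "\<lambda>q. indicator (unit_cube (2 * dbar)) q :: ennreal"
  note [measurable] = measurable_query_deviation[OF D] unit_cube_in_sets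
  define u where "u q = ennreal \<bar>query_deviation D q\<bar>" for q
  have u[measurable]: "u \<in> borel_measurable ?L" unfolding u_def by measurable
  have "indicator (query_space dbar) q * ennreal \<bar>h q - query_fun i dbar m n D q\<bar>
      \<le> ennreal (real n) * (ennreal \<epsilon> * ?I q + u q * ?I q)" for q
  proof (cases "q \<in> query_space dbar")
    case True
    then have q: "q \<in> unit_cube (2 * dbar)" by (simp add: query_space_def)
    have triangle: "\<bar>a - b\<bar> \<le> A + B" if "\<bar>a - c\<bar> \<le> A" "\<bar>b - c\<bar> = B" for a b c A B :: real
      using that by linarith
    have "query_deviation D q = (query_fun i dbar m n D q - real n * mean_query q) / real n"
      using True by (simp add: restricted_query_def query_fun_eq_sum sum_subtractf)
    then have "query_fun i dbar m n D q - real n * mean_query q = real n * query_deviation D q"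
      using n by simp
    then have "\<bar>query_fun i dbar m n D q - real n * mean_query q\<bar> = real n * \<bar>query_deviation D q\<bar>"
      by (simp only: abs_mult abs_of_nat)
    then have "\<bar>h q - query_fun i dbar m n D q\<bar> \<le> real n * \<epsilon> + real n * \<bar>query_deviation D q\<bar>"
      by (rule triangle[OF h[OF True]])
    also have "\<dots> = real n * (\<epsilon> + \<bar>query_deviation D q\<bar>)" by (simp only: distrib_left)
    finally have "ennreal \<bar>h q - query_fun i dbar m n D q\<bar> \<le> ennreal (real n * (\<epsilon> + \<bar>query_deviation D q\<bar>))"
      by (rule ennreal_leI)
    also have "\<dots> = ennreal (real n) * (ennreal \<epsilon> + u q)"
      using \<epsilon> unfolding u_def by (simp add: ennreal_mult ennreal_plus)
    finally show ?thesis using True q by simp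
  qed simp
  then have "L1_Q dbar h (query_fun i dbar m n D) \<le> (\<integral>\<^sup>+q. ennreal (real n) * (ennreal \<epsilon> * ?I q + u q * ?I q) \<partial>?L)"
    unfolding L1_Q_def by (intro nn_integral_mono)
  also have "\<dots> = ennreal (real n) * (ennreal \<epsilon> + (\<integral>\<^sup>+q. u q * ?I q \<partial>?L))"
    by (simp add: nn_integral_cmult nn_integral_add emeasure_unit_cube)
  also have "(\<integral>\<^sup>+q. u q * ?I q \<partial>?L) = (\<integral>\<^sup>+q. \<bar>query_deviation D q\<bar> \<partial>query_measure)"
    using nn_integral_query_measure[OF u] by (simp only: u_def)
  finally have "ennreal (1 / real n) * L1_Q dbar h (query_fun i dbar m n D)
      \<le> ennreal (1 / real n) * (ennreal (real n) * (ennreal \<epsilon> + (\<integral>\<^sup>+q. \<bar>query_deviation D q\<bar> \<partial>query_measure)))"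
    by (rule mult_left_mono) simp
  also have "\<dots> = ennreal \<epsilon> + (\<integral>\<^sup>+q. \<bar>query_deviation D q\<bar> \<partial>query_measure)"
    using n by (simp add: mult.assoc[symmetric] flip: ennreal_mult)
  finally show ?thesis .
qed

text \<open>The query function is jointly measurable in database and query, and integrating the
  query out over a sigma-finite measure preserves measurability.\<close>

lemma measurable_L1_Q_query_fun:
  assumes h: "h \<in> borel_measurable (lebesgue_k (2 * dbar))"
  shows "(\<lambda>D. L1_Q dbar h (query_fun i dbar m n D)) \<in> borel_measurable (db_measure Chi n)"
proof -
  let ?L = "lebesgue_k (2 * dbar)"
  let ?P = "db_measure Chi n"
  interpret sigma_finite_measure ?L by (rule sigma_finite_lebesgue_k)
  have "(\<lambda>x. point_query i dbar m (fst x k) (snd x)) \<in> borel_measurable (?P \<Otimes>\<^sub>M ?L)" if "k \<in> {..<n}" for k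
  proof (intro measurable_point_query m)
    fix j assume "j < dbar"
    then show "(\<lambda>x. fst x k j) \<in> borel_measurable (?P \<Otimes>\<^sub>M ?L)"
      using that unfolding db_measure_def
      by (intro measurable_compose[OF measurable_fst] measurable_compose[OF measurable_component_singleton]
          measurable_Chi_component)
  next
    fix j assume "j < 2 * dbar"
    then show "(\<lambda>x. snd x j) \<in> borel_measurable (?P \<Otimes>\<^sub>M ?L)"
      by (intro measurable_compose[OF measurable_snd] measurable_lebesgue_k_component)
  qed
  then have [measurable]: "(\<lambda>x. query_fun i dbar m n (fst x) (snd x)) \<in> borel_measurable (?P \<Otimes>\<^sub>M ?L)"
    unfolding query_fun_eq_sum by (rule borel_measurable_sum)
  note [measurable] = h query_space_in_sets
  show ?thesis
    unfolding L1_Q_def by (rule borel_measurable_nn_integral) (unfold case_prod_beta, measurable)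
qed

text \<open>The network is built from \<open>mean_query\<close> alone, independently of
  \<open>D\<close>. Its error uses up \<open>\<epsilon>1\<close>, so the event forces the sampling
  deviation to reach \<open>\<epsilon>2\<close>, where \<open>query_deviation_tail\<close>
  applies.\<close>

lemma exists_net_for_query:
  fixes \<epsilon>1 \<epsilon>2 :: real
  assumes \<epsilon>1: "0 < \<epsilon>1" and \<epsilon>2: "0 < \<epsilon>2"
    and lip: "\<exists>\<rho>. l1_lipschitz_on (2 * dbar) \<rho> (unit_cube (2 * dbar)) (dist_query_fun i dbar m Chi n)"
  defines "\<rho> \<equiv> l1_lipschitz_const (2 * dbar) (unit_cube (2 * dbar)) (dist_query_fun i dbar m Chi n)"
  defines "S \<equiv> real (2 * dbar) * (20 * \<rho> * real (2 * dbar) / \<epsilon>1 + 1) ^ (2 * dbar)"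
  defines "B \<equiv> 1000 * S * ln (2 + S + real n + 1 / \<epsilon>1)"
  shows "\<exists>N. nn_wf (2 * dbar) N \<and> real (nn_space N) \<le> B \<and> real (nn_time N) \<le> B \<and>
    (let E = {D \<in> space (db_measure Chi n). ennreal (\<epsilon>1 + \<epsilon>2)
        \<le> ennreal (1 / real n) * L1_Q dbar (nn_fun (2 * dbar) N) (query_fun i dbar m n D)}
     in E \<in> sets (db_measure Chi n) \<and>
        measure (db_measure Chi n) E \<le> 2 ^ (2 * dbar + 1) * real (2 * dbar)
          * \<epsilon>2 powr (- real (2 * dbar)) * exp (- (\<epsilon>2\<^sup>2 * real n) / 2))"
proof -
  let ?d = "2 * dbar"
  let ?M = "db_measure Chi n"
  note lip = l1_lipschitz_const_props[OF lip, folded \<rho>_def]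
  have F: "dist_query_fun i dbar m Chi n = mean_query" using dist_query_fun_eq_mean_query by blast
  obtain N g where N: "nn_wf ?d N" "real (nn_space N) \<le> B" "real (nn_time N) \<le> B"
    and g: "g \<in> borel_measurable (lebesgue_k ?d)"
    and approx: "\<And>q. q \<in> unit_cube ?d \<Longrightarrow> nn_fun ?d N q = real n * g q \<and> \<bar>g q - mean_query q\<bar> \<le> \<epsilon>1"
    using exists_net_approx[of ?d n \<epsilon>1 \<rho> mean_query, folded S_def, folded B_def]
      m n \<epsilon>1 lip[unfolded F] mean_query_mem_unit_interval mean_query_zero
    by auto
  define E where "E = {D \<in> space ?M. ennreal (\<epsilon>1 + \<epsilon>2)
      \<le> ennreal (1 / real n) * L1_Q dbar (nn_fun ?d N) (query_fun i dbar m n D)}"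
  \<comment> \<open>The integral sees only the query space, where the network equals the measurable
    function \<open>real n * g\<close>; this makes \<open>E\<close> measurable.\<close>
  have "L1_Q dbar (nn_fun ?d N) f = L1_Q dbar (\<lambda>q. real n * g q) f" for f
    unfolding L1_Q_def using approx
    by (intro nn_integral_cong) (auto simp: query_space_def split: split_indicator)
  moreover have [measurable]: "(\<lambda>D. L1_Q dbar (\<lambda>q. real n * g q) (query_fun i dbar m n D)) \<in> borel_measurable ?M"
    using g by (intro measurable_L1_Q_query_fun) measurable
  ultimately have E: "E \<in> sets ?M" unfolding E_def by simp
  let ?W = "\<lambda>D. \<integral>\<^sup>+q. \<bar>query_deviation D q\<bar> \<partial>query_measure"
  have sub: "E \<subseteq> {D \<in> space ?M. ennreal \<epsilon>2 \<le> ?W D}"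
  proof
    fix D assume D: "D \<in> E"
    have "\<bar>nn_fun ?d N q - real n * mean_query q\<bar> \<le> real n * \<epsilon>1" if "q \<in> query_space dbar" for q
    proof -
      have "q \<in> unit_cube ?d" using that by (simp add: query_space_def)
      from approx[OF this] have "nn_fun ?d N q - real n * mean_query q = real n * (g q - mean_query q)"
        "\<bar>g q - mean_query q\<bar> \<le> \<epsilon>1" by (auto simp: algebra_simps)
      then show ?thesis by (simp add: abs_mult mult_left_mono)
    qed
    then have "ennreal (1 / real n) * L1_Q dbar (nn_fun ?d N) (query_fun i dbar m n D) \<le> ennreal \<epsilon>1 + ?W D"
      using D \<epsilon>1 by (intro L1_Q_le_deviation) (auto simp: E_def)
    then have "ennreal (\<epsilon>1 + \<epsilon>2) \<le> ennreal \<epsilon>1 + ?W D"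
      using D unfolding E_def by (blast intro: order_trans)
    also have "ennreal (\<epsilon>1 + \<epsilon>2) = ennreal \<epsilon>1 + ennreal \<epsilon>2"
      using \<epsilon>1 \<epsilon>2 by (intro ennreal_plus) auto
    finally have "ennreal \<epsilon>2 \<le> ?W D"
      unfolding ennreal_add_left_cancel_le by simp
    then show "D \<in> {D \<in> space ?M. ennreal \<epsilon>2 \<le> ?W D}"
      using D unfolding E_def by blast
  qed
  interpret prob_space ?M unfolding db_measure_def by (intro prob_space_PiM Chi)
  have "measure ?M E \<le> measure ?M {D \<in> space ?M. ennreal \<epsilon>2 \<le> ?W D}"
    by (rule finite_measure_mono[OF sub query_deviation_tail(1)[OF \<epsilon>2]])
  then show ?thesis
    using N E query_deviation_tail(2)[OF \<epsilon>2] unfolding E_def Let_def by (blast intro: order_trans)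
qed

end

theorem theorem3p1:
  shows "\<exists>\<kappa>1>0. \<exists>\<kappa>2>0. \<exists>C>0. \<exists>k::nat.
    \<forall>(dbar::nat) (Chi::(nat \<Rightarrow> real) measure) (n::nat) (m::nat) (i::agg) (\<epsilon>1::real) (\<epsilon>2::real).
      1 \<le> dbar \<longrightarrow> prob_space Chi \<longrightarrow>
      sets Chi = sets (PiM {..<dbar} (\<lambda>_. borel :: real measure)) \<longrightarrow>
      emeasure Chi (unit_cube dbar) = 1 \<longrightarrow>
      1 \<le> n \<longrightarrow> m < dbar \<longrightarrow> 0 < \<epsilon>1 \<longrightarrow> 0 < \<epsilon>2 \<longrightarrow>
      (\<exists>\<rho>. l1_lipschitz_on (2 * dbar) \<rho> (unit_cube (2 * dbar)) (dist_query_fun i dbar m Chi n)) \<longrightarrow>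
      (let d = 2 * dbar;
           \<rho> = l1_lipschitz_const d (unit_cube d) (dist_query_fun i dbar m Chi n);
           S = real d * (\<kappa>1 * \<rho> * real d / \<epsilon>1 + 1) ^ d;
           B = C * S * (ln (2 + S + real n + 1 / \<epsilon>1)) ^ k;
           M = db_measure Chi n
       in \<exists>N. nn_wf d N \<and> real (nn_space N) \<le> B \<and> real (nn_time N) \<le> B \<and>
             (let E = {D \<in> space M. ennreal (\<epsilon>1 + \<epsilon>2)
                          \<le> ennreal (1 / real n) * L1_Q dbar (nn_fun d N) (query_fun i dbar m n D)}
              in E \<in> sets M \<and>
                 measure M E \<le> \<kappa>2 ^ (d + 1) * real d * \<epsilon>2 powr (- real d)
                                 * exp (- (\<epsilon>2\<^sup>2 * real n) / \<kappa>2)))"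
  \<comment> \<open>20 comes from the count of grid cones, 2 from the dimension-dependent form of
    the tail, and 1000 absorbs the factors from network size and bit length; a single logarithm
    suffices.\<close>
  apply (rule exI[of _ 20], rule conjI, simp, rule exI[of _ 2], rule conjI, simp)
  apply (rule exI[of _ 1000], rule conjI, simp, rule exI[of _ 1], intro allI impI)
  unfolding Let_def power_one_right
  by (rule exists_net_for_query[unfolded Let_def])

end
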